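(* Let $\{g_i\}_{i=1}^\infty$ be a general pre-Fréchet frame for $X_F$ with respect to $\Theta_F$, with associated index sequences $\{s_k\}_{k\in\mathbb N_0}$, $\{\widetilde s_k\}_{k\in\mathbb N_0}$. (a) Let $\Theta_s$, $s\in\mathbb N_0$, be $CB$-spaces, and let there exist a continuous operator $V:\Theta_F\to X_F$ such that $V\{g_i(f)\}_{i=1}^\infty=f$ for all $f\in X_F$. Then there exists a sequence $\{f_i\}_{i=1}^\infty$ in $X_F$ such that $$\text{(E1)}\quad f=\sum_{i=1}^\infty g_i(f)f_i\ \text{ (in } X_F),\quad\text{for every } f\in X_F,$$ $$\text{(E2)}\quad g=\sum_{i=1}^\infty g(f_i)g_i\ \text{ (in } X_F^* ),\quad\text{for every } g\in X_F^*.$$ (b) Let $\Theta_s$, $s\in\mathbb N_0$, be $CB$-spaces. Then the following three statements are equivalent: $\mathcal A_1$: There exists an operator $V:\Theta_F\to X_F$ such that $V\{g_i(f)\}_{i=1}^\infty=f$ for all $f\in X_F$, and for every $k\in\mathbb N_0$ there is a constant $C_k>0$ satisfying $\|Vd\|_{s_k}\le C_k|||d|||_k$ for all $d\in\Theta_F$. $\mathcal A_2$: There exists a sequence $\{f_i\}_{i=1}^\infty$ in $X_F$ such that for every $k\in\mathbb N_0$, $\{f_i\}_{i=1}^\infty$ is a $\Theta_k^*$-Bessel sequence for $X_{s_k}^*$, and (E1) holds. $\mathcal A_3$: There exists a sequence $\{f_i\}_{i=1}^\infty$ in $X_F$ such that for every $k\in\mathbb N_0$, $\{f_i\}_{i=1}^\infty$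 is a $\Theta_k^*$-Bessel sequence for $X_{s_k}^*$, and $$\text{(E3)}\quad f=\sum_{i=1}^\infty g_i^{\widetilde s_k}(f)f_i\ \text{ in } \|\cdot\|_{s_k}\text{-norm},\quad\text{for every } f\in X_{\widetilde s_k}.$$ In particular, the equivalent conditions $\mathcal A_1$–$\mathcal A_3$ imply validity of (E1), (E2), and (E3) for every $k\in\mathbb N_0$, with the same sequence $\{f_i\}_{i=1}^\infty=\{Ve_i\}_{i=1}^\infty$, where $V$ is the operator from $\mathcal A_1$. (c) Let $\Theta_s$ and $\Theta_s^*$, $s\in\mathbb N_0$, be $CB$-spaces. Then $\mathcal A_1$ is equivalent to $\mathcal A_4$: There exists a sequence $\{f_i\}_{i=1}^\infty$ in $X_F$ such that for every $k\in\mathbb N_0$, $\{f_i\}_{i=1}^\infty$ is an $(X_{\widetilde s_k}^*,\Theta_k^*,X_{s_k}^* )$-frame, and $$\text{(E4)}\quad g|_{X_{\widetilde s_k}}=\sum_{i=1}^\infty g(f_i)\,g_i^{\widetilde s_k}\ \text{ in } \|\cdot\|_{X_{\widetilde s_k}^*}\text{-norm},\quad\text{for every } g\in X_{s_k}^*.$$ In particular, the equivalent conditions $\mathcal A_1$–$\mathcal A_4$ imply validity of (E1), (E2), and (E3), (E4) for every $k\in\mathbb N_0$, with the same sequence $\{f_i\}_{i=1}^\infty=\{Ve_i\}_{i=1}^\infty$, where $V$ is the operator from $\mathcal A_1$.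
   Context: Linear mappings are called operators. $\mathbb N_0=\{0,1,2,\dots\}$; $e_i=\{\delta_{ki}\}_{k=1}^\infty$ is the $i$-th canonical vector. A $BK$-space is a Banach space of scalar sequences on which all coordinate functionals are continuous. A $CB$-space is a $BK$-space for which the canonical vectors form a Schauder basis. If $\Theta$ is a $CB$-space, its dual $\Theta^*$ is always identified with the $BK$-space $\Theta^{\circledast}=\{\{h(e_i)\}_{i=1}^\infty: h\in\Theta^*\}$ normed by $|||\{h(e_i)\}_{i=1}^\infty|||_{\Theta^\circledast}=\|h\|_{\Theta^*}$ (an isometric isomorphism); "$\Theta^*$ is a $CB$-space" is meant under this identification. Admissible scale: a sequence $\{(Y_s,|\cdot|_s)\}_{s\in\mathbb N_0}$ of separable Banach spaces such that $\{0\}\ne\bigcap_{s\in\mathbb N_0}Y_s\subseteq\dots\subseteq Y_2\subseteq Y_1\subseteq Y_0$; $|\cdot|_0\le|\cdot|_1\le|\cdot|_2\le\cdots$ (each inequality on the smaller space); and $Y_F:=\bigcap_{s\in\mathbb N_0}Y_s$ is dense in $Y_s$ for every $s\in\mathbb N_0$. $Y_F$ is a Fréchet space with the sequence of norms $|\cdot|_s$, $s\in\mathbb N_0$. Throughout, $X_F=\bigcap_s X_s$ is the Fréchet space of an admissible scale $\{(X_s,\|\cdot\|_s)\}_{s\in\mathbb N_0}$, and $\Theta_F=\bigcap_s\Theta_s$ is the Fréchet space of an admissible scale $\{(\Theta_s,|||\cdot|||_s)\}_{s\in\mathbb N_0}$ of $BK$-spaces. $X_F^*$ is the dual of $X_F$.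 A sequence $\{g_i\}_{i=1}^\infty$ in $X_F^*$ is a general pre-Fréchet frame for $X_F$ with respect to $\Theta_F$ if there exist sequences $\{\widetilde s_k\}_{k\in\mathbb N_0},\{s_k\}_{k\in\mathbb N_0}\subseteq\mathbb N_0$ which increase to $\infty$, with $s_k\le\widetilde s_k$ for all $k\in\mathbb N_0$, and constants $A_k,B_k>0$, $k\in\mathbb N_0$, such that for all $f\in X_F$ and all $k\in\mathbb N_0$: $\{g_i(f)\}_{i=1}^\infty\in\Theta_F$ and $A_k\|f\|_{s_k}\le|||\{g_i(f)\}_{i=1}^\infty|||_k\le B_k\|f\|_{\widetilde s_k}$. The sequences $\{s_k\}$, $\{\widetilde s_k\}$ are fixed as in this definition. For every $i$ and $k$, $g_i$ has a unique continuous extension to $X_{\widetilde s_k}$, denoted $g_i^{\widetilde s_k}$. Given Banach spaces $Z_2\subseteq Z_1$ with $\|\cdot\|_{Z_1}\le\|\cdot\|_{Z_2}$ on $Z_2$ and a $BK$-space $(\Theta,|||\cdot|||)$, a sequence $\{h_i\}_{i=1}^\infty$ in $Z_2^*$ is a $\Theta$-Bessel sequence for $Z_2$ if there is $B<\infty$ with $\{h_i(z)\}_{i=1}^\infty\in\Theta$ and $|||\{h_i(z)\}_{i=1}^\infty|||\le B\|z\|_{Z_2}$ for all $z\in Z_2$; it is a $(Z_1,\Theta,Z_2)$-frame if there are $0<A\le B<\infty$ such that for all $z\in Z_2$, $\{h_i(z)\}_{i=1}^\infty\in\Theta$ and $A\|z\|_{Z_1}\le|||\{h_i(z)\}_{i=1}^\infty|||\le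 B\|z\|_{Z_2}$. These notions are applied to $f_i\in X_F\subseteq X_{s_k}$ viewed as functionals $g\mapsto g(f_i)$ on $X_{s_k}^*$, and $X_{s_k}^*$ is regarded as a subspace of $X_{\widetilde s_k}^*$ via the (injective) restriction $g\mapsto g|_{X_{\widetilde s_k}}$. Thus $\{f_i\}$ is a $\Theta_k^*$-Bessel sequence for $X_{s_k}^*$ iff for some $B<\infty$: $\{g(f_i)\}_{i=1}^\infty\in\Theta_k^*$ and $|||\{g(f_i)\}_{i=1}^\infty|||_{\Theta_k^*}\le B\|g\|_{X_{s_k}^*}$ for all $g\in X_{s_k}^*$; and it is an $(X_{\widetilde s_k}^*,\Theta_k^*,X_{s_k}^* )$-frame iff in addition $A\|g|_{X_{\widetilde s_k}}\|_{X_{\widetilde s_k}^*}\le|||\{g(f_i)\}_{i=1}^\infty|||_{\Theta_k^*}$ for some $A>0$ and all $g\in X_{s_k}^*$. *)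

theory Defs
  imports "HOL-Analysis.Analysis" "HOL-Library.Function_Algebras"
begin

text \<open>
  Scalars: \<open>'k::{real_normed_field, euclidean_space}\<close> has the instances real and complex and, up
  to isometric isomorphism, no others (Gelfand--Mazur).

  All spaces \<open>Y\<close> are linear subspaces (sets) of an ambient vector space over \<open>'k\<close> with scalar
  multiplication \<open>sc\<close>, so that several nested spaces with different norms can live side by side.
  Norms, operators and functionals are total functions, of which only the values on the respective
  space matter.  In particular a functional on a space and its restriction to a smaller space are
  the same function, and the identification of \<open>Z\<^sup>*\<close> with a subspace of \<open>Y\<^sup>*\<close> for \<open>Y\<close> dense in
  \<open>Z\<close> becomes a plain inclusion of sets of functions.

  Sequences are indexed from 0 instead of 1.
\<close>

definition fun_scale :: "'k::times \<Rightarrow> ('i \<Rightarrow> 'k) \<Rightarrow> 'i \<Rightarrow> 'k" where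
  "fun_scale c d = (\<lambda>i. c * d i)"

definition unit_seq :: "nat \<Rightarrow> nat \<Rightarrow> 'k::zero_neq_one" where
  "unit_seq i = (\<lambda>k. if k = i then 1 else 0)"

definition operator_on ::
  "('k \<Rightarrow> 'a::plus \<Rightarrow> 'a) \<Rightarrow> ('k \<Rightarrow> 'b::plus \<Rightarrow> 'b) \<Rightarrow> 'a set \<Rightarrow> 'b set \<Rightarrow> ('a \<Rightarrow> 'b) \<Rightarrow> bool" where
  "operator_on sc1 sc2 Y Z T \<longleftrightarrow>
     (\<forall>x\<in>Y. T x \<in> Z) \<and>
     (\<forall>x\<in>Y. \<forall>y\<in>Y. T (x + y) = T x + T y) \<and>
     (\<forall>c. \<forall>x\<in>Y. T (sc1 c x) = sc2 c (T x))"

definition series_in :: "'a::comm_monoid_add topology \<Rightarrow> (nat \<Rightarrow> 'a) \<Rightarrow> 'a \<Rightarrow> bool" where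
  "series_in T u l \<longleftrightarrow> limitin T (\<lambda>n. \<Sum>i<n. u i) l sequentially"


subsection \<open>Normed and Banach spaces\<close>

definition norm_on ::
  "('k::{real_normed_field,euclidean_space} \<Rightarrow> 'a::ab_group_add \<Rightarrow> 'a) \<Rightarrow> 'a set \<Rightarrow> ('a \<Rightarrow> real) \<Rightarrow> bool" where
  "norm_on sc Y n \<longleftrightarrow>
     module.subspace sc Y \<and>
     (\<forall>x\<in>Y. 0 \<le> n x) \<and> (\<forall>x\<in>Y. n x = 0 \<longleftrightarrow> x = 0) \<and>
     (\<forall>x\<in>Y. \<forall>y\<in>Y. n (x + y) \<le> n x + n y) \<and>
     (\<forall>c. \<forall>x\<in>Y. n (sc c x) = norm c * n x)"

text \<open>The value off \<open>Y\<close> is irrelevant; it is 0 because the locale \<open>Metric_space\<close> requires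
  nonnegativity and symmetry on the whole type.\<close>

definition norm_dist :: "'a::ab_group_add set \<Rightarrow> ('a \<Rightarrow> real) \<Rightarrow> 'a \<Rightarrow> 'a \<Rightarrow> real" where
  "norm_dist Y n x y = (if x \<in> Y \<and> y \<in> Y then n (x - y) else 0)"

definition norm_topology :: "'a::ab_group_add set \<Rightarrow> ('a \<Rightarrow> real) \<Rightarrow> 'a topology" where
  "norm_topology Y n = Metric_space.mtopology Y (norm_dist Y n)"

definition banach_on ::
  "('k::{real_normed_field,euclidean_space} \<Rightarrow> 'a::ab_group_add \<Rightarrow> 'a) \<Rightarrow> 'a set \<Rightarrow> ('a \<Rightarrow> real) \<Rightarrow> bool" where
  "banach_on sc Y n \<longleftrightarrow> norm_on sc Y n \<and> Metric_space.mcomplete Y (norm_dist Y n)"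

definition schauder_basis ::
  "('k \<Rightarrow> 'a::ab_group_add \<Rightarrow> 'a) \<Rightarrow> 'a set \<Rightarrow> ('a \<Rightarrow> real) \<Rightarrow> (nat \<Rightarrow> 'a) \<Rightarrow> bool" where
  "schauder_basis sc Y n b \<longleftrightarrow>
     (\<forall>i. b i \<in> Y) \<and>
     (\<forall>y\<in>Y. \<exists>!c. series_in (norm_topology Y n) (\<lambda>i. sc (c i) (b i)) y)"

definition banach_dual ::
  "('k::{real_normed_field,euclidean_space} \<Rightarrow> 'a::ab_group_add \<Rightarrow> 'a) \<Rightarrow> 'a set \<Rightarrow> ('a \<Rightarrow> real) \<Rightarrow> ('a \<Rightarrow> 'k) set" where
  "banach_dual sc Y n = {h. operator_on sc (*) Y UNIV h \<and> (\<exists>C. \<forall>y\<in>Y. norm (h y) \<le> C * n y)}"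

definition dual_norm :: "'a set \<Rightarrow> ('a \<Rightarrow> real) \<Rightarrow> ('a \<Rightarrow> 'k::real_normed_field) \<Rightarrow> real" where
  "dual_norm Y n h = (SUP y\<in>{y\<in>Y. n y \<le> 1}. norm (h y))"

text \<open>The continuous extension to \<open>Y\<close> of a functional \<open>h\<close> given on a dense subset \<open>D\<close>; where it
  exists, its values on \<open>Y\<close> are uniquely determined.\<close>

definition cont_ext ::
  "('k::{real_normed_field,euclidean_space} \<Rightarrow> 'a::ab_group_add \<Rightarrow> 'a) \<Rightarrow> 'a set \<Rightarrow> ('a \<Rightarrow> real) \<Rightarrow> 'a set
    \<Rightarrow> ('a \<Rightarrow> 'k) \<Rightarrow> 'a \<Rightarrow> 'k" where
  "cont_ext sc Y n D h = (SOME h'. h' \<in> banach_dual sc Y n \<and> (\<forall>x\<in>D. h' x = h x))"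


subsection \<open>Sequence spaces\<close>

definition BK_space :: "(nat \<Rightarrow> 'k::{real_normed_field,euclidean_space}) set \<Rightarrow> ((nat \<Rightarrow> 'k) \<Rightarrow> real) \<Rightarrow> bool" where
  "BK_space \<Theta> n \<longleftrightarrow> banach_on fun_scale \<Theta> n \<and> (\<forall>i. (\<lambda>d. d i) \<in> banach_dual fun_scale \<Theta> n)"

definition CB_space :: "(nat \<Rightarrow> 'k::{real_normed_field,euclidean_space}) set \<Rightarrow> ((nat \<Rightarrow> 'k) \<Rightarrow> real) \<Rightarrow> bool" where
  "CB_space \<Theta> n \<longleftrightarrow> BK_space \<Theta> n \<and> schauder_basis fun_scale \<Theta> n unit_seq"

text \<open>The dual of a CB-space as a sequence space, with the norm carried over from the dual.
  The functional \<open>h\<close> in the definition of the norm is unique on \<open>\<Theta>\<close> if \<open>\<Theta>\<close> is a CB-space.\<close>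

definition seq_dual ::
  "(nat \<Rightarrow> 'k::{real_normed_field,euclidean_space}) set \<Rightarrow> ((nat \<Rightarrow> 'k) \<Rightarrow> real) \<Rightarrow> (nat \<Rightarrow> 'k) set" where
  "seq_dual \<Theta> n = {(\<lambda>i. h (unit_seq i)) | h. h \<in> banach_dual fun_scale \<Theta> n}"

definition seq_dual_norm ::
  "(nat \<Rightarrow> 'k::{real_normed_field,euclidean_space}) set \<Rightarrow> ((nat \<Rightarrow> 'k) \<Rightarrow> real) \<Rightarrow> (nat \<Rightarrow> 'k) \<Rightarrow> real" where
  "seq_dual_norm \<Theta> n c =
     (THE r. \<exists>h\<in>banach_dual fun_scale \<Theta> n. c = (\<lambda>i. h (unit_seq i)) \<and> r = dual_norm \<Theta> n h)"


subsection \<open>Admissible scales and their Frechet spaces\<close>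

definition admissible_scale ::
  "('k::{real_normed_field,euclidean_space} \<Rightarrow> 'a::ab_group_add \<Rightarrow> 'a) \<Rightarrow> (nat \<Rightarrow> 'a set) \<Rightarrow> (nat \<Rightarrow> 'a \<Rightarrow> real) \<Rightarrow> bool" where
  "admissible_scale sc Y n \<longleftrightarrow>
     (\<forall>s. banach_on sc (Y s) (n s) \<and> separable_space (norm_topology (Y s) (n s))) \<and>
     (\<Inter>s. Y s) \<noteq> {0} \<and>
     (\<forall>s. Y (Suc s) \<subseteq> Y s) \<and>
     (\<forall>s. \<forall>x\<in>Y (Suc s). n s x \<le> n (Suc s) x) \<and>
     (\<forall>s. norm_topology (Y s) (n s) closure_of (\<Inter>r. Y r) = Y s)"

text \<open>The topology on \<open>D\<close> generated by the balls of a family \<open>P\<close> of seminorms.\<close>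

definition seminorm_topology :: "'a::ab_group_add set \<Rightarrow> ('a \<Rightarrow> real) set \<Rightarrow> 'a topology" where
  "seminorm_topology D P = topology_generated_by {{y\<in>D. p (y - x) < e} | p x e. p \<in> P \<and> x \<in> D}"

definition frechet_topology :: "(nat \<Rightarrow> 'a::ab_group_add set) \<Rightarrow> (nat \<Rightarrow> 'a \<Rightarrow> real) \<Rightarrow> 'a topology" where
  "frechet_topology Y n = seminorm_topology (\<Inter>s. Y s) (range n)"

definition frechet_dual ::
  "('k::{real_normed_field,euclidean_space} \<Rightarrow> 'a::ab_group_add \<Rightarrow> 'a) \<Rightarrow> (nat \<Rightarrow> 'a set) \<Rightarrow> (nat \<Rightarrow> 'a \<Rightarrow> real) \<Rightarrow> ('a \<Rightarrow> 'k) set" where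
  "frechet_dual sc Y n =
     {h. operator_on sc (*) (\<Inter>s. Y s) UNIV h \<and> continuous_map (frechet_topology Y n) euclidean h}"

definition weak_star_topology ::
  "('k::{real_normed_field,euclidean_space} \<Rightarrow> 'a::ab_group_add \<Rightarrow> 'a) \<Rightarrow> (nat \<Rightarrow> 'a set) \<Rightarrow> (nat \<Rightarrow> 'a \<Rightarrow> real) \<Rightarrow> ('a \<Rightarrow> 'k) topology" where
  "weak_star_topology sc Y n =
     seminorm_topology (frechet_dual sc Y n) {(\<lambda>h. norm (h x)) | x. x \<in> (\<Inter>s. Y s)}"


subsection \<open>Frames\<close>

text \<open>General pre-Frechet frame with associated index sequences \<open>s\<close> and \<open>t\<close> (the latter being
  written with a tilde in the literature).\<close>

definition pre_frechet_frame ::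
  "('k::{real_normed_field,euclidean_space} \<Rightarrow> 'a::ab_group_add \<Rightarrow> 'a) \<Rightarrow> (nat \<Rightarrow> 'a set) \<Rightarrow> (nat \<Rightarrow> 'a \<Rightarrow> real)
    \<Rightarrow> (nat \<Rightarrow> (nat \<Rightarrow> 'k) set) \<Rightarrow> (nat \<Rightarrow> (nat \<Rightarrow> 'k) \<Rightarrow> real)
    \<Rightarrow> (nat \<Rightarrow> nat) \<Rightarrow> (nat \<Rightarrow> nat) \<Rightarrow> (nat \<Rightarrow> 'a \<Rightarrow> 'k) \<Rightarrow> bool" where
  "pre_frechet_frame sc X nX \<Theta> n\<Theta> s t g \<longleftrightarrow>
     (\<forall>i. g i \<in> frechet_dual sc X nX) \<and>
     mono s \<and> filterlim s at_top sequentially \<and>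
     mono t \<and> filterlim t at_top sequentially \<and>
     (\<forall>k. s k \<le> t k) \<and>
     (\<exists>A B. \<forall>k. 0 < A k \<and> 0 < B k \<and>
        (\<forall>f\<in>(\<Inter>r. X r). (\<lambda>i. g i f) \<in> (\<Inter>r. \<Theta> r) \<and>
           A k * nX (s k) f \<le> n\<Theta> k (\<lambda>i. g i f) \<and>
           n\<Theta> k (\<lambda>i. g i f) \<le> B k * nX (t k) f))"

definition bessel_sequence ::
  "('k::{real_normed_field,euclidean_space} \<Rightarrow> 'z::ab_group_add \<Rightarrow> 'z) \<Rightarrow> (nat \<Rightarrow> 'k) set \<Rightarrow> ((nat \<Rightarrow> 'k) \<Rightarrow> real)
    \<Rightarrow> 'z set \<Rightarrow> ('z \<Rightarrow> real) \<Rightarrow> (nat \<Rightarrow> 'z \<Rightarrow> 'k) \<Rightarrow> bool" where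
  "bessel_sequence sc \<Theta> n\<Theta> Z nZ h \<longleftrightarrow>
     (\<forall>i. h i \<in> banach_dual sc Z nZ) \<and>
     (\<exists>B. \<forall>z\<in>Z. (\<lambda>i. h i z) \<in> \<Theta> \<and> n\<Theta> (\<lambda>i. h i z) \<le> B * nZ z)"

text \<open>\<open>(Z1, \<Theta>, Z2)\<close>-frame, where \<open>Z2 \<subseteq> Z1\<close> and the larger space \<open>Z1\<close> enters only through its
  norm \<open>nZ1\<close>.\<close>

definition banach_frame ::
  "('k::{real_normed_field,euclidean_space} \<Rightarrow> 'z::ab_group_add \<Rightarrow> 'z) \<Rightarrow> ('z \<Rightarrow> real)
    \<Rightarrow> (nat \<Rightarrow> 'k) set \<Rightarrow> ((nat \<Rightarrow> 'k) \<Rightarrow> real)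
    \<Rightarrow> 'z set \<Rightarrow> ('z \<Rightarrow> real) \<Rightarrow> (nat \<Rightarrow> 'z \<Rightarrow> 'k) \<Rightarrow> bool" where
  "banach_frame sc nZ1 \<Theta> n\<Theta> Z2 nZ2 h \<longleftrightarrow>
     (\<forall>i. h i \<in> banach_dual sc Z2 nZ2) \<and>
     (\<exists>A B. 0 < A \<and> A \<le> B \<and>
        (\<forall>z\<in>Z2. (\<lambda>i. h i z) \<in> \<Theta> \<and> A * nZ1 z \<le> n\<Theta> (\<lambda>i. h i z) \<and> n\<Theta> (\<lambda>i. h i z) \<le> B * nZ2 z))"


subsection \<open>The expansions\<close>

definition E1 ::
  "('k::{real_normed_field,euclidean_space} \<Rightarrow> 'a::ab_group_add \<Rightarrow> 'a) \<Rightarrow> (nat \<Rightarrow> 'a set) \<Rightarrow> (nat \<Rightarrow> 'a \<Rightarrow> real)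
    \<Rightarrow> (nat \<Rightarrow> 'a \<Rightarrow> 'k) \<Rightarrow> (nat \<Rightarrow> 'a) \<Rightarrow> bool" where
  "E1 sc X nX g f \<longleftrightarrow>
     (\<forall>x\<in>(\<Inter>r. X r). series_in (frechet_topology X nX) (\<lambda>i. sc (g i x) (f i)) x)"

text \<open>Convergence in the dual of the Frechet space is weak* convergence.  For the strong
  dual topology the expansion fails in general: take all spaces of both scales equal to
  \<open>\<ell>\<^sup>1\<close>, the coordinate functionals for \<open>g\<close> and the unit vectors for \<open>f\<close>.\<close>

definition E2 ::
  "('k::{real_normed_field,euclidean_space} \<Rightarrow> 'a::ab_group_add \<Rightarrow> 'a) \<Rightarrow> (nat \<Rightarrow> 'a set) \<Rightarrow> (nat \<Rightarrow> 'a \<Rightarrow> real)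
    \<Rightarrow> (nat \<Rightarrow> 'a \<Rightarrow> 'k) \<Rightarrow> (nat \<Rightarrow> 'a) \<Rightarrow> bool" where
  "E2 sc X nX g f \<longleftrightarrow>
     (\<forall>h\<in>frechet_dual sc X nX. series_in (weak_star_topology sc X nX) (\<lambda>i. fun_scale (h (f i)) (g i)) h)"

text \<open>\<open>E3\<close> and \<open>E4\<close> are stated for a single pair of indices \<open>p \<le> q\<close>, to be instantiated with
  \<open>p = s k\<close> and \<open>q = t k\<close>.\<close>

definition E3 ::
  "('k::{real_normed_field,euclidean_space} \<Rightarrow> 'a::ab_group_add \<Rightarrow> 'a) \<Rightarrow> (nat \<Rightarrow> 'a set) \<Rightarrow> (nat \<Rightarrow> 'a \<Rightarrow> real)
    \<Rightarrow> nat \<Rightarrow> nat \<Rightarrow> (nat \<Rightarrow> 'a \<Rightarrow> 'k) \<Rightarrow> (nat \<Rightarrow> 'a) \<Rightarrow> bool" where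
  "E3 sc X nX p q g f \<longleftrightarrow>
     (\<forall>x\<in>X q. series_in (norm_topology (X p) (nX p))
        (\<lambda>i. sc (cont_ext sc (X q) (nX q) (\<Inter>r. X r) (g i) x) (f i)) x)"

definition E4 ::
  "('k::{real_normed_field,euclidean_space} \<Rightarrow> 'a::ab_group_add \<Rightarrow> 'a) \<Rightarrow> (nat \<Rightarrow> 'a set) \<Rightarrow> (nat \<Rightarrow> 'a \<Rightarrow> real)
    \<Rightarrow> nat \<Rightarrow> nat \<Rightarrow> (nat \<Rightarrow> 'a \<Rightarrow> 'k) \<Rightarrow> (nat \<Rightarrow> 'a) \<Rightarrow> bool" where
  "E4 sc X nX p q g f \<longleftrightarrow>
     (\<forall>h\<in>banach_dual sc (X p) (nX p).
        (\<lambda>n. dual_norm (X q) (nX q)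
            (h - (\<Sum>i<n. fun_scale (h (f i)) (cont_ext sc (X q) (nX q) (\<Inter>r. X r) (g i)))))
          \<longlonglongrightarrow> 0)"


subsection \<open>The equivalent conditions\<close>

definition A1_operator ::
  "('k::{real_normed_field,euclidean_space} \<Rightarrow> 'a::ab_group_add \<Rightarrow> 'a) \<Rightarrow> (nat \<Rightarrow> 'a set) \<Rightarrow> (nat \<Rightarrow> 'a \<Rightarrow> real)
    \<Rightarrow> (nat \<Rightarrow> (nat \<Rightarrow> 'k) set) \<Rightarrow> (nat \<Rightarrow> (nat \<Rightarrow> 'k) \<Rightarrow> real)
    \<Rightarrow> (nat \<Rightarrow> nat) \<Rightarrow> (nat \<Rightarrow> 'a \<Rightarrow> 'k) \<Rightarrow> ((nat \<Rightarrow> 'k) \<Rightarrow> 'a) \<Rightarrow> bool" where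
  "A1_operator sc X nX \<Theta> n\<Theta> s g V \<longleftrightarrow>
     operator_on fun_scale sc (\<Inter>r. \<Theta> r) (\<Inter>r. X r) V \<and>
     (\<forall>f\<in>(\<Inter>r. X r). V (\<lambda>i. g i f) = f) \<and>
     (\<forall>k. \<exists>C>0. \<forall>d\<in>(\<Inter>r. \<Theta> r). nX (s k) (V d) \<le> C * n\<Theta> k d)"

text \<open>The vectors \<open>f i\<close> act on \<open>X\<^sub>p\<^sup>*\<close> as evaluation functionals.\<close>

definition dual_bessel ::
  "('k::{real_normed_field,euclidean_space} \<Rightarrow> 'a::ab_group_add \<Rightarrow> 'a) \<Rightarrow> (nat \<Rightarrow> 'a set) \<Rightarrow> (nat \<Rightarrow> 'a \<Rightarrow> real)
    \<Rightarrow> (nat \<Rightarrow> 'k) set \<Rightarrow> ((nat \<Rightarrow> 'k) \<Rightarrow> real) \<Rightarrow> nat \<Rightarrow> (nat \<Rightarrow> 'a) \<Rightarrow> bool" where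
  "dual_bessel sc X nX \<Theta> n\<Theta> p f \<longleftrightarrow>
     bessel_sequence fun_scale (seq_dual \<Theta> n\<Theta>) (seq_dual_norm \<Theta> n\<Theta>)
       (banach_dual sc (X p) (nX p)) (dual_norm (X p) (nX p)) (\<lambda>i h. h (f i))"

definition dual_frame ::
  "('k::{real_normed_field,euclidean_space} \<Rightarrow> 'a::ab_group_add \<Rightarrow> 'a) \<Rightarrow> (nat \<Rightarrow> 'a set) \<Rightarrow> (nat \<Rightarrow> 'a \<Rightarrow> real)
    \<Rightarrow> (nat \<Rightarrow> 'k) set \<Rightarrow> ((nat \<Rightarrow> 'k) \<Rightarrow> real) \<Rightarrow> nat \<Rightarrow> nat \<Rightarrow> (nat \<Rightarrow> 'a) \<Rightarrow> bool" where
  "dual_frame sc X nX \<Theta> n\<Theta> p q f \<longleftrightarrow>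
     banach_frame fun_scale (dual_norm (X q) (nX q))
       (seq_dual \<Theta> n\<Theta>) (seq_dual_norm \<Theta> n\<Theta>)
       (banach_dual sc (X p) (nX p)) (dual_norm (X p) (nX p)) (\<lambda>i h. h (f i))"

definition A2_sequence ::
  "('k::{real_normed_field,euclidean_space} \<Rightarrow> 'a::ab_group_add \<Rightarrow> 'a) \<Rightarrow> (nat \<Rightarrow> 'a set) \<Rightarrow> (nat \<Rightarrow> 'a \<Rightarrow> real)
    \<Rightarrow> (nat \<Rightarrow> (nat \<Rightarrow> 'k) set) \<Rightarrow> (nat \<Rightarrow> (nat \<Rightarrow> 'k) \<Rightarrow> real)
    \<Rightarrow> (nat \<Rightarrow> nat) \<Rightarrow> (nat \<Rightarrow> 'a \<Rightarrow> 'k) \<Rightarrow> (nat \<Rightarrow> 'a) \<Rightarrow> bool" where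
  "A2_sequence sc X nX \<Theta> n\<Theta> s g f \<longleftrightarrow>
     (\<forall>i. f i \<in> (\<Inter>r. X r)) \<and>
     (\<forall>k. dual_bessel sc X nX (\<Theta> k) (n\<Theta> k) (s k) f) \<and>
     E1 sc X nX g f"

definition A3_sequence ::
  "('k::{real_normed_field,euclidean_space} \<Rightarrow> 'a::ab_group_add \<Rightarrow> 'a) \<Rightarrow> (nat \<Rightarrow> 'a set) \<Rightarrow> (nat \<Rightarrow> 'a \<Rightarrow> real)
    \<Rightarrow> (nat \<Rightarrow> (nat \<Rightarrow> 'k) set) \<Rightarrow> (nat \<Rightarrow> (nat \<Rightarrow> 'k) \<Rightarrow> real)
    \<Rightarrow> (nat \<Rightarrow> nat) \<Rightarrow> (nat \<Rightarrow> nat) \<Rightarrow> (nat \<Rightarrow> 'a \<Rightarrow> 'k) \<Rightarrow> (nat \<Rightarrow> 'a) \<Rightarrow> bool" where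
  "A3_sequence sc X nX \<Theta> n\<Theta> s t g f \<longleftrightarrow>
     (\<forall>i. f i \<in> (\<Inter>r. X r)) \<and>
     (\<forall>k. dual_bessel sc X nX (\<Theta> k) (n\<Theta> k) (s k) f \<and> E3 sc X nX (s k) (t k) g f)"

definition A4_sequence ::
  "('k::{real_normed_field,euclidean_space} \<Rightarrow> 'a::ab_group_add \<Rightarrow> 'a) \<Rightarrow> (nat \<Rightarrow> 'a set) \<Rightarrow> (nat \<Rightarrow> 'a \<Rightarrow> real)
    \<Rightarrow> (nat \<Rightarrow> (nat \<Rightarrow> 'k) set) \<Rightarrow> (nat \<Rightarrow> (nat \<Rightarrow> 'k) \<Rightarrow> real)
    \<Rightarrow> (nat \<Rightarrow> nat) \<Rightarrow> (nat \<Rightarrow> nat) \<Rightarrow> (nat \<Rightarrow> 'a \<Rightarrow> 'k) \<Rightarrow> (nat \<Rightarrow> 'a) \<Rightarrow> bool" where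
  "A4_sequence sc X nX \<Theta> n\<Theta> s t g f \<longleftrightarrow>
     (\<forall>i. f i \<in> (\<Inter>r. X r)) \<and>
     (\<forall>k. dual_frame sc X nX (\<Theta> k) (n\<Theta> k) (s k) (t k) f \<and> E4 sc X nX (s k) (t k) g f)"

end

theory Submission
  imports Defs
begin

text \<open>
  The vectors of the expansions are \<open>f\<^sub>i = V e\<^sub>i\<close>. Applying \<open>V\<close> to the basis expansion of
  \<open>(g\<^sub>i x)\<^sub>i\<close> gives \<open>E1\<close>, and the estimates for \<open>V\<close> carry it over to the completions
  (\<open>E3\<close>). A functional \<open>h\<close> composed with \<open>V\<close> extends by density to some \<open>\<phi>\<close> in the
  dual of \<open>\<Theta>\<^sub>k\<close> with \<open>\<phi> e\<^sub>i = h f\<^sub>i\<close>; this gives the Bessel and frame inequalities and, expanding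
  \<open>\<phi>\<close> in the basis of the dual, \<open>E4\<close>. Conversely, the Bessel inequality bounds \<open>\<Sum> d\<^sub>i f\<^sub>i\<close> by the
  norm of \<open>\<Sum> d\<^sub>i e\<^sub>i\<close> because the dual is norming (Hahn--Banach), so \<open>V d = \<Sum> d\<^sub>i f\<^sub>i\<close> converges
  and is bounded.
\<close>

subsection \<open>Scalars and topologies\<close>

text \<open>Every estimate loses from \<open>t k\<close> to \<open>s k\<close>: the coefficient
  functionals extend to \<open>X (t k)\<close>, whereas \<open>V\<close> is controlled only in the
  norm of index \<open>s k\<close>. Hence \<open>E3\<close> takes \<open>x\<close> from
  \<open>X (t k)\<close> and converges in \<open>X (s k)\<close>, and on the duals \<open>E4\<close>
  runs the opposite way. Nothing is lost for the Frechet space: \<open>s\<close> is unbounded, so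
  the norms of index \<open>s k\<close> already determine the topology of \<open>XF\<close>. The
  pivot is the identity \<open>h x = \<phi> (\<lambda>i. gext k i x)\<close> on
  \<open>X (t k)\<close>. It factors \<open>h\<close> through the extended analysis map, whose norm
  is at most the upper frame constant \<open>B\<close>. This gives the lower frame bound for
  \<open>f\<close>, and it turns the remainder in \<open>E4\<close> into the remainder of the basis
  expansion of \<open>\<phi>\<close>. Since the norms live on sets and the scalars are an abstract
  field, the norming functionals are built in two stages: a real one as a minimal sublinear
  functional, then its scalar version by means of an algebraic form of conjugation.\<close>

text \<open>The type classes do not link the inner product to multiplication directly. The norm is
  multiplicative, and polarization carries this over to the inner product.\<close>

lemma inner_mult_left_same:
  fixes a :: "'k::{real_normed_field,euclidean_space}"
  shows "inner (a * x) (a * y) = (norm a)\<^sup>2 * inner x y"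
proof -
  have "inner (a * x) (a * y) = ((norm (a * x + a * y))\<^sup>2 - (norm (a * x))\<^sup>2 - (norm (a * y))\<^sup>2) / 2"
    by (simp add: power2_norm_eq_inner inner_add_left inner_add_right inner_commute)
  also have "\<dots> = (norm a)\<^sup>2 * (((norm (x + y))\<^sup>2 - (norm x)\<^sup>2 - (norm y)\<^sup>2) / 2)"
    unfolding distrib_left[symmetric] norm_mult power_mult_distrib
    by (simp add: right_diff_distrib diff_divide_distrib)
  also have "((norm (x + y))\<^sup>2 - (norm x)\<^sup>2 - (norm y)\<^sup>2) / 2 = inner x y"
    by (simp add: power2_norm_eq_inner inner_add_left inner_add_right inner_commute)
  finally show ?thesis .
qed

text \<open>Complex conjugation, written as a quotient by means of
  \<open>norm c ^ 2 = c * conj c\<close>, so that it makes sense over the abstract field; it is the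
  identity over the reals. At 0 the convention for division gives 0.\<close>

definition scalar_conj :: "'k::{real_normed_field,euclidean_space} \<Rightarrow> 'k" where
  "scalar_conj c = of_real ((norm c)\<^sup>2) / c"

lemma scalar_conj_1 [simp]: "scalar_conj 1 = 1"
  by (simp add: scalar_conj_def)

lemma scalar_conj_mult: "scalar_conj (a * b) = scalar_conj a * scalar_conj b"
  by (simp add: scalar_conj_def norm_mult power_mult_distrib)

lemma norm_scalar_conj [simp]: "norm (scalar_conj a) = norm a"
proof -
  have "norm (scalar_conj a) = \<bar>(norm a)\<^sup>2\<bar> / norm a"
    unfolding scalar_conj_def norm_divide norm_of_real ..
  then show ?thesis by (simp add: power2_eq_square)
qed

lemma scalar_conj_conj [simp]: "scalar_conj (scalar_conj a) = a"
proof (cases "a = 0")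
  case False
  have "scalar_conj (scalar_conj a) = of_real ((norm a)\<^sup>2) / scalar_conj a"
    unfolding scalar_conj_def[of "scalar_conj a"] by simp
  with False show ?thesis by (simp add: scalar_conj_def)
qed (simp add: scalar_conj_def)

text \<open>Writing \<open>y\<close> as \<open>a * (y / a)\<close> puts the factor \<open>a\<close>
  on both sides, where it comes out as \<open>(norm a)\<^sup>2\<close>; thus
  \<open>scalar_conj a\<close> gives the adjoint of multiplication by \<open>a\<close>.\<close>

lemma inner_mult_scalar_conj: "inner (a * x) y = inner x (scalar_conj a * y)"
proof (cases "a = 0")
  case False
  have "inner (a * x) (a * (y / a)) = (norm a)\<^sup>2 * inner x (y / a)"
    by (rule inner_mult_left_same)
  then show ?thesis
    using False by (simp add: scalar_conj_def flip: inner_scaleR_right) (simp add: scaleR_conv_of_real)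
qed (simp add: scalar_conj_def)

lemma inner_scalar_conj: "inner (scalar_conj a) x = inner 1 (a * x)"
  using inner_mult_scalar_conj[of "scalar_conj a" 1 x] by simp

text \<open>Additivity is invisible in the quotient, but by adjointness the inner product of
  \<open>scalar_conj a\<close> with any \<open>x\<close> is \<open>inner 1 (a * x)\<close>, which is
  linear in \<open>a\<close>.\<close>

lemma linear_scalar_conj: "linear scalar_conj"
  by (rule linearI; rule vector_eq_rdot[THEN iffD1])
     (simp_all add: inner_add_left inner_add_right inner_scalar_conj distrib_left distrib_right)

lemma le_zero_if_le_mult_epsilon:
  fixes a :: real
  assumes "C \<ge> 0" "\<And>e. e > 0 \<Longrightarrow> a \<le> C * e"
  shows "a \<le> 0"
proof (rule field_le_epsilon)
  fix e :: real assume "e > 0"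
  \<comment> \<open>Dividing by \<open>C + 1\<close> instead of \<open>C\<close> keeps the case
    \<open>C = 0\<close>.\<close>
  then have "a \<le> C * (e / (C + 1))" using assms(1) by (intro assms(2)) simp
  also have "\<dots> \<le> e" using \<open>e > 0\<close> assms(1) by (simp add: field_simps)
  finally show "a \<le> 0 + e" by simp
qed

text \<open>The balls are only a subbasis, but eventual membership passes to finite intersections
  and to unions, so induction over the generated sets reduces convergence to single balls. A
  nonempty \<open>P\<close> makes the balls cover \<open>D\<close>, which is therefore the
  \<open>topspace\<close>.\<close>

lemma limitin_seminorm_topology:
  assumes "P \<noteq> {}"
    and zero: "\<And>p. p \<in> P \<Longrightarrow> p 0 = 0"
    and nonneg: "\<And>p x y. p \<in> P \<Longrightarrow> x \<in> D \<Longrightarrow> y \<in> D \<Longrightarrow> 0 \<le> p (x - y)"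
    and tri: "\<And>p x y z. p \<in> P \<Longrightarrow> x \<in> D \<Longrightarrow> y \<in> D \<Longrightarrow> z \<in> D \<Longrightarrow> p (x - z) \<le> p (x - y) + p (y - z)"
  shows "limitin (seminorm_topology D P) u l F \<longleftrightarrow>
     l \<in> D \<and> (\<forall>\<^sub>F m in F. u m \<in> D) \<and> (\<forall>p\<in>P. ((\<lambda>m. p (u m - l)) \<longlongrightarrow> 0) F)"
proof -
  let ?S = "{{y\<in>D. p (y - x) < e} | p x e. p \<in> P \<and> x \<in> D}"
  obtain p0 where p0: "p0 \<in> P" using assms(1) by blast
  have ball: "openin (seminorm_topology D P) {y\<in>D. p (y - x) < e}" if "p \<in> P" "x \<in> D" for p x e
    unfolding seminorm_topology_def using that by (intro topology_generated_by_Basis) blast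
  have top: "topspace (seminorm_topology D P) = D"
  proof
    show "topspace (seminorm_topology D P) \<subseteq> D"
      unfolding seminorm_topology_def topology_generated_by_topspace by blast
    show "D \<subseteq> topspace (seminorm_topology D P)"
    proof
      fix x assume x: "x \<in> D"
      have "x \<in> {y\<in>D. p0 (y - x) < 1}" using x zero[OF p0] by simp
      then show "x \<in> topspace (seminorm_topology D P)"
        using ball[OF p0 x, of 1] openin_subset by blast
    qed
  qed
  show ?thesis
  proof (intro iffI conjI ballI; (elim conjE)?)
    assume lim: "limitin (seminorm_topology D P) u l F"
    show l: "l \<in> D" using limitin_topspace[OF lim] unfolding top .
    have ev: "\<forall>\<^sub>F m in F. u m \<in> D \<and> p (u m - l) < e" if "p \<in> P" "e > 0" for p e
      using limitinD[OF lim ball[OF that(1) l, of e]] l zero[OF that(1)] that(2) by simp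
    show "\<forall>\<^sub>F m in F. u m \<in> D" using ev[OF p0 zero_less_one] by eventually_elim simp
    fix p assume p: "p \<in> P"
    show "((\<lambda>m. p (u m - l)) \<longlongrightarrow> 0) F"
    proof (rule tendstoI)
      fix e :: real assume "e > 0"
      from ev[OF p this] show "\<forall>\<^sub>F m in F. dist (p (u m - l)) 0 < e"
        by eventually_elim (use nonneg[OF p _ l] in auto)
    qed
  next
    assume l: "l \<in> D" and D: "\<forall>\<^sub>F m in F. u m \<in> D"
      and p: "\<forall>p\<in>P. ((\<lambda>m. p (u m - l)) \<longlongrightarrow> 0) F"
    have "\<forall>\<^sub>F m in F. u m \<in> U" if "generate_topology_on ?S U" "l \<in> U" for U
      using that
    proof (induction rule: generate_topology_on.induct)
      case (UN K) 
      then obtain k where "k \<in> K" "l \<in> k" by blast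
      with UN.IH[OF this] show ?case by (auto elim!: eventually_mono)
    next
      case (Basis B)
      then obtain p' x e where B: "B = {y\<in>D. p' (y - x) < e}" "p' \<in> P" "x \<in> D" by blast
      \<comment> \<open>What remains of the radius at \<open>l\<close>, the ball being centred at
        \<open>x\<close>; the triangle inequality then recentres it at \<open>l\<close>.\<close>
      have "e - p' (l - x) > 0" using Basis B by simp
      then have "\<forall>\<^sub>F m in F. p' (u m - l) < e - p' (l - x)"
        by (rule order_tendstoD(2)[OF p[rule_format, OF B(2)]])
      with D show ?case
      proof eventually_elim
        case (elim m)
        then show ?case using tri[OF B(2) elim(1) l B(3)] B by auto
      qed
    qed (auto simp: eventually_conj_iff)
    then show "limitin (seminorm_topology D P) u l F"
      unfolding limitin_def top using l
      by (auto simp: seminorm_topology_def openin_topology_generated_by_iff)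
  qed
qed

section \<open>Norms on subspaces of an ambient vector space\<close>

locale normed_subspace = vector_space sc
  for sc :: "'k::{real_normed_field,euclidean_space} \<Rightarrow> 'a::ab_group_add \<Rightarrow> 'a" +
  fixes Y :: "'a set" and n :: "'a \<Rightarrow> real"
  assumes norm_on: "norm_on sc Y n"
begin

lemma subspace_Y: "subspace Y"
  and nonneg: "x \<in> Y \<Longrightarrow> 0 \<le> n x"
  and eq_0_iff: "x \<in> Y \<Longrightarrow> n x = 0 \<longleftrightarrow> x = 0"
  and triangle: "x \<in> Y \<Longrightarrow> y \<in> Y \<Longrightarrow> n (x + y) \<le> n x + n y"
  and norm_scale: "x \<in> Y \<Longrightarrow> n (sc c x) = norm c * n x"
  using norm_on by (auto simp: norm_on_def)

lemma mem_0 [simp]: "0 \<in> Y"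
  and mem_add: "x \<in> Y \<Longrightarrow> y \<in> Y \<Longrightarrow> x + y \<in> Y"
  and mem_diff: "x \<in> Y \<Longrightarrow> y \<in> Y \<Longrightarrow> x - y \<in> Y"
  and mem_neg: "x \<in> Y \<Longrightarrow> - x \<in> Y"
  and mem_scale: "x \<in> Y \<Longrightarrow> sc c x \<in> Y"
  and mem_sum: "(\<And>i. i \<in> I \<Longrightarrow> f i \<in> Y) \<Longrightarrow> sum f I \<in> Y"
  using subspace_Y
  by (auto intro: subspace_0 subspace_add subspace_diff subspace_neg subspace_scale subspace_sum)

lemma norm_0 [simp]: "n 0 = 0"
  using eq_0_iff by simp

lemma norm_neg: "x \<in> Y \<Longrightarrow> n (- x) = n x"
  using norm_scale[of x "-1"] by simp

lemma norm_diff_commute: "x \<in> Y \<Longrightarrow> y \<in> Y \<Longrightarrow> n (x - y) = n (y - x)"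
  using norm_neg[of "x - y"] mem_diff by simp

lemma triangle_diff: "x \<in> Y \<Longrightarrow> y \<in> Y \<Longrightarrow> n (x - y) \<le> n x + n y"
  using triangle[of x "- y"] mem_neg norm_neg by simp

lemma triangle_via: "x \<in> Y \<Longrightarrow> y \<in> Y \<Longrightarrow> z \<in> Y \<Longrightarrow> n (x - z) \<le> n (x - y) + n (y - z)"
  using triangle[of "x - y" "y - z"] mem_diff by simp

sublocale M: Metric_space Y "norm_dist Y n"
proof
  show "0 \<le> norm_dist Y n x y" for x y
    by (simp add: norm_dist_def nonneg mem_diff)
  show "norm_dist Y n x y = norm_dist Y n y x" for x y
    by (simp add: norm_dist_def norm_diff_commute)
  show "norm_dist Y n x y = 0 \<longleftrightarrow> x = y" if "x \<in> Y" "y \<in> Y" for x y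
    using that by (simp add: norm_dist_def eq_0_iff mem_diff)
  show "norm_dist Y n x z \<le> norm_dist Y n x y + norm_dist Y n y z"
    if "x \<in> Y" "y \<in> Y" "z \<in> Y" for x y z
    using that by (simp add: norm_dist_def triangle_via)
qed

lemma limitin_norm:
  "limitin (norm_topology Y n) u l F \<longleftrightarrow>
     l \<in> Y \<and> (\<forall>\<^sub>F m in F. u m \<in> Y) \<and> ((\<lambda>m. n (u m - l)) \<longlongrightarrow> 0) F"
proof -
  have "(\<forall>e>0. \<forall>\<^sub>F m in F. u m \<in> Y \<and> norm_dist Y n (u m) l < e) \<longleftrightarrow>
      (\<forall>\<^sub>F m in F. u m \<in> Y) \<and> ((\<lambda>m. n (u m - l)) \<longlongrightarrow> 0) F" if l: "l \<in> Y"
  proof (intro iffI conjI allI impI; (elim conjE)?)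
    assume *: "\<forall>e>0. \<forall>\<^sub>F m in F. u m \<in> Y \<and> norm_dist Y n (u m) l < e"
    show "\<forall>\<^sub>F m in F. u m \<in> Y"
      using *[rule_format, OF zero_less_one] by eventually_elim simp
    show "((\<lambda>m. n (u m - l)) \<longlongrightarrow> 0) F"
    proof (rule tendstoI)
      fix e :: real assume "e > 0"
      with * have "\<forall>\<^sub>F m in F. u m \<in> Y \<and> norm_dist Y n (u m) l < e" by blast
      then show "\<forall>\<^sub>F m in F. dist (n (u m - l)) 0 < e"
        by eventually_elim (use l nonneg mem_diff in \<open>auto simp: norm_dist_def\<close>)
    qed
  next
    fix e :: real
    assume "e > 0" "((\<lambda>m. n (u m - l)) \<longlongrightarrow> 0) F" and D: "\<forall>\<^sub>F m in F. u m \<in> Y"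
    then have "\<forall>\<^sub>F m in F. n (u m - l) < e" by (auto dest: order_tendstoD(2))
    with D show "\<forall>\<^sub>F m in F. u m \<in> Y \<and> norm_dist Y n (u m) l < e"
      by eventually_elim (use l in \<open>auto simp: norm_dist_def\<close>)
  qed
  then show ?thesis
    unfolding norm_topology_def M.limitin_metric by blast
qed

lemma dense_approx:
  assumes "norm_topology Y n closure_of D = Y" "x \<in> Y" "e > 0"
  obtains y where "y \<in> D" "y \<in> Y" "n (y - x) < e"
proof -
  have "x \<in> M.mtopology closure_of D"
    using assms by (simp add: norm_topology_def)
  with \<open>e > 0\<close> obtain y where "y \<in> D" "y \<in> M.mball x e"
    unfolding M.metric_closure_of by blast
  with that norm_diff_commute show thesis
    by (auto simp: M.mball_def norm_dist_def split: if_splits)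
qed

lemma Cauchy_limit:
  assumes "M.mcomplete" "\<And>i. u i \<in> Y"
    and "\<And>e. e > 0 \<Longrightarrow> \<exists>N. \<forall>i\<ge>N. \<forall>j\<ge>N. n (u i - u j) < e"
  obtains l where "l \<in> Y" "(\<lambda>m. n (u m - l)) \<longlonglongrightarrow> 0"
proof -
  have "M.MCauchy u"
    unfolding M.MCauchy_def using assms(2,3) by (auto simp: norm_dist_def)
  then obtain l where "limitin (norm_topology Y n) u l sequentially"
    using assms(1) by (auto simp: M.mcomplete_def norm_topology_def)
  with that show thesis by (auto simp: limitin_norm)
qed

lemma limit_unique:
  assumes "\<And>i. u i \<in> Y" "l \<in> Y" "l' \<in> Y"
    "(\<lambda>m. n (u m - l)) \<longlonglongrightarrow> 0" "(\<lambda>m. n (u m - l')) \<longlonglongrightarrow> 0"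
  shows "l = l'"
proof -
  have "(\<lambda>m. n (u m - l) + n (u m - l')) \<longlonglongrightarrow> 0"
    using tendsto_add[OF assms(4,5)] by simp
  then have "n (l - l') \<le> 0"
    by (rule LIMSEQ_le_const)
       (use assms(1-3) triangle_via[of l _ l'] norm_diff_commute[of l] in auto)
  then have "n (l - l') = 0" using nonneg[of "l - l'"] mem_diff[OF assms(2,3)] by simp
  then show ?thesis using eq_0_iff mem_diff[OF assms(2,3)] by simp
qed

end

subsection \<open>The Hahn--Banach theorem\<close>

context normed_subspace
begin

abbreviation scaleR' :: "real \<Rightarrow> 'a \<Rightarrow> 'a" where
  "scaleR' r x \<equiv> sc (of_real r) x"

text \<open>Domination by \<open>n\<close> is built in because it bounds all these functionals from
  below as well, so that pointwise infima exist. The value 0 off \<open>Y\<close> makes the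
  pointwise order antisymmetric as an order on total functions, as Zorn's lemma needs.\<close>

definition sublinear :: "('a \<Rightarrow> real) \<Rightarrow> bool" where
  "sublinear q \<longleftrightarrow> (\<forall>x\<in>Y. \<forall>y\<in>Y. q (x + y) \<le> q x + q y) \<and>
     (\<forall>r>0. \<forall>x\<in>Y. q (scaleR' r x) \<le> r * q x) \<and> (\<forall>x\<in>Y. q x \<le> n x) \<and> (\<forall>x. x \<notin> Y \<longrightarrow> q x = 0)"

lemma sublinearI:
  assumes "\<And>x y. x \<in> Y \<Longrightarrow> y \<in> Y \<Longrightarrow> q (x + y) \<le> q x + q y"
    "\<And>r x. r > 0 \<Longrightarrow> x \<in> Y \<Longrightarrow> q (scaleR' r x) \<le> r * q x"
    "\<And>x. x \<in> Y \<Longrightarrow> q x \<le> n x" "\<And>x. x \<notin> Y \<Longrightarrow> q x = 0"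
  shows "sublinear q"
  using assms by (auto simp: sublinear_def)

lemma sublinearD:
  assumes "sublinear q"
  shows "x \<in> Y \<Longrightarrow> y \<in> Y \<Longrightarrow> q (x + y) \<le> q x + q y"
    and "r > 0 \<Longrightarrow> x \<in> Y \<Longrightarrow> q (scaleR' r x) \<le> r * q x"
    and "x \<in> Y \<Longrightarrow> q x \<le> n x"
    and "x \<notin> Y \<Longrightarrow> q x = 0"
  using assms by (auto simp: sublinear_def)

lemma sublinear_0:
  assumes "sublinear q"
  shows "q 0 = 0"
  using sublinearD(1)[OF assms, of 0 0] sublinearD(3)[OF assms, of 0] by simp

lemma sublinear_scale:
  assumes "sublinear q" "r \<ge> 0" "x \<in> Y"
  shows "q (scaleR' r x) = r * q x"
proof (cases "r = 0")
  case False
  then have r: "r > 0" using assms by simp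
  have "q (scaleR' (1 / r) (scaleR' r x)) \<le> 1 / r * q (scaleR' r x)"
    by (intro sublinearD(2)) (use assms r mem_scale in auto)
  then have "r * q x \<le> q (scaleR' r x)" using r by (simp add: field_simps)
  with sublinearD(2)[OF assms(1) r assms(3)] show ?thesis by simp
qed (use sublinear_0[OF assms(1)] in simp)

text \<open>A lower bound common to all sublinear functionals; it makes the pointwise infimum over a
  chain finite.\<close>

lemma sublinear_ge:
  assumes "sublinear q" "x \<in> Y"
  shows "- n x \<le> q x"
  using sublinearD(1)[OF assms(1), of x "- x"] sublinearD(3)[OF assms(1), of "- x"]
    sublinear_0[OF assms(1)] assms norm_neg mem_neg by force

text \<open>The device that forces additivity: \<open>tilt z q\<close> lies below \<open>q\<close>
  by taking \<open>r = 0\<close>, and \<open>r = 1\<close> gives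
  \<open>tilt z q (- z) \<le> - q z\<close>, which is the inequality that a linear functional
  satisfies along \<open>z\<close>.\<close>

definition tilt :: "'a \<Rightarrow> ('a \<Rightarrow> real) \<Rightarrow> 'a \<Rightarrow> real" where
  "tilt z q y = (if y \<in> Y then INF r\<in>{0..}. q (y + scaleR' r z) - r * q z else 0)"

text \<open>Subadditivity at \<open>(y + scaleR' r z) + - y\<close> gives a bound that does not
  depend on \<open>r\<close>, so the infimum in \<open>tilt\<close> is over a set bounded
  below.\<close>

lemma tilt_lower:
  assumes "sublinear q" "z \<in> Y" "y \<in> Y" "r \<ge> 0"
  shows "- n y \<le> q (y + scaleR' r z) - r * q z"
proof -
  have "r * q z = q ((y + scaleR' r z) + - y)"
    using sublinear_scale[OF assms(1,4,2)] by simp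
  also have "\<dots> \<le> q (y + scaleR' r z) + q (- y)"
    by (intro sublinearD(1)[OF assms(1)] mem_add mem_neg mem_scale assms)
  also have "q (- y) \<le> n y"
    using sublinearD(3)[OF assms(1), of "- y"] assms mem_neg norm_neg by simp
  finally show ?thesis by simp
qed

lemma tilt_le:
  assumes "sublinear q" "z \<in> Y" "y \<in> Y" "r \<ge> 0"
  shows "tilt z q y \<le> q (y + scaleR' r z) - r * q z"
proof -
  have "bdd_below ((\<lambda>r. q (y + scaleR' r z) - r * q z) ` {0..})"
    by (intro bdd_belowI2[where m = "- n y"]) (use tilt_lower[OF assms(1-3)] in auto)
  with assms show ?thesis
    unfolding tilt_def by (auto intro: cINF_lower)
qed

lemma tilt_approx:
  assumes "y \<in> Y" "e > 0"
  obtains r where "r \<ge> 0" "q (y + scaleR' r z) - r * q z < tilt z q y + e"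
proof (rule ccontr)
  assume no: "\<not> thesis"
  have "tilt z q y + e \<le> q (y + scaleR' r z) - r * q z" if "r \<ge> 0" for r
    using no that \<open>\<And>r. \<lbrakk>0 \<le> r; q (y + scaleR' r z) - r * q z < tilt z q y + e\<rbrakk> \<Longrightarrow> thesis\<close> by force
  then have "tilt z q y + e \<le> (INF r\<in>{0..}. q (y + scaleR' r z) - r * q z)"
    by (intro cINF_greatest) auto
  with assms show False by (simp add: tilt_def)
qed

lemma tilt_le_self:
  assumes "sublinear q" "z \<in> Y"
  shows "tilt z q y \<le> q y"
  using tilt_le[OF assms, of y 0] sublinearD(4)[OF assms(1), of y]
  by (cases "y \<in> Y") (auto simp: tilt_def)

text \<open>Near-minimal parameters combine: \<open>r1 + r2\<close> serves the sum of two vectors,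
  and \<open>c * r\<close> serves the multiple by \<open>c\<close>.\<close>

lemma sublinear_tilt:
  assumes q: "sublinear q" and z: "z \<in> Y"
  shows "sublinear (tilt z q)"
proof (rule sublinearI)
  fix x y assume xy: "x \<in> Y" "y \<in> Y"
  show "tilt z q (x + y) \<le> tilt z q x + tilt z q y"
  proof (rule field_le_epsilon)
    fix e :: real assume "e > 0"
    then have e: "e / 2 > 0" by simp
    obtain r1 where r1: "r1 \<ge> 0" "q (x + scaleR' r1 z) - r1 * q z < tilt z q x + e / 2"
      using tilt_approx[OF xy(1) e] by blast
    obtain r2 where r2: "r2 \<ge> 0" "q (y + scaleR' r2 z) - r2 * q z < tilt z q y + e / 2"
      using tilt_approx[OF xy(2) e] by blast
    have "tilt z q (x + y) \<le> q ((x + y) + scaleR' (r1 + r2) z) - (r1 + r2) * q z"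
      using r1 r2 by (intro tilt_le q z mem_add xy) simp
    also have "(x + y) + scaleR' (r1 + r2) z = (x + scaleR' r1 z) + (y + scaleR' r2 z)"
      by (simp add: scale_left_distrib)
    also have "q \<dots> \<le> q (x + scaleR' r1 z) + q (y + scaleR' r2 z)"
      by (intro sublinearD(1)[OF q] mem_add mem_scale xy z)
    finally show "tilt z q (x + y) \<le> tilt z q x + tilt z q y + e"
      using r1 r2 by (simp add: algebra_simps)
  qed
next
  fix c :: real and x assume c: "c > 0" and x: "x \<in> Y"
  show "tilt z q (scaleR' c x) \<le> c * tilt z q x"
  proof (rule field_le_epsilon)
    fix e :: real assume "e > 0"
    then have e: "e / c > 0" using c by simp
    obtain r where r: "r \<ge> 0" "q (x + scaleR' r z) - r * q z < tilt z q x + e / c"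
      using tilt_approx[OF x e] by blast
    have "tilt z q (scaleR' c x) \<le> q (scaleR' c x + scaleR' (c * r) z) - (c * r) * q z"
      using r c by (intro tilt_le q z mem_scale x) simp
    also have "scaleR' c x + scaleR' (c * r) z = scaleR' c (x + scaleR' r z)"
      by (simp add: scale_right_distrib)
    also have "q \<dots> \<le> c * q (x + scaleR' r z)"
      by (intro sublinearD(2)[OF q] mem_add mem_scale x z c)
    also have "c * q (x + scaleR' r z) - c * r * q z = c * (q (x + scaleR' r z) - r * q z)"
      by (simp add: algebra_simps)
    also have "\<dots> \<le> c * (tilt z q x + e / c)"
      using r c by (intro mult_left_mono) auto
    finally show "tilt z q (scaleR' c x) \<le> c * tilt z q x + e"
      using c by (simp add: algebra_simps)
  qed
next
  show "tilt z q x \<le> n x" if "x \<in> Y" for x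
    using tilt_le_self[OF q z, of x] sublinearD(3)[OF q that] by simp
qed (simp add: tilt_def)

text \<open>A minimal sublinear functional equals all its tilts and is therefore additive.\<close>

lemma real_norming_functional:
  assumes x0: "x0 \<in> Y"
  obtains \<phi> where "\<forall>x\<in>Y. \<forall>y\<in>Y. \<phi> (x + y) = \<phi> x + \<phi> y"
    and "\<forall>r. \<forall>x\<in>Y. \<phi> (scaleR' r x) = r * \<phi> x"
    and "\<forall>x\<in>Y. \<phi> x \<le> n x" and "\<phi> x0 = n x0"
proof -
  \<comment> \<open>The constraint at \<open>- x0\<close> is stable under passing to smaller
    functionals. Once the minimal functional is additive, it becomes
    \<open>n x0 \<le> \<phi> x0\<close>.\<close>
  define A where "A = {q. sublinear q \<and> q (- x0) \<le> - n x0}"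
  \<comment> \<open>The order is reversed, so the maximal element delivered by Zorn's lemma is a
    minimal functional.\<close>
  define P where "P = (\<lambda>a b :: 'a \<Rightarrow> real. \<forall>x. b x \<le> a x)"
  define N where "N = (\<lambda>x. if x \<in> Y then n x else 0)"
  have N: "sublinear N"
    by (rule sublinearI) (auto simp: N_def triangle mem_add mem_scale norm_scale)
  \<comment> \<open>At \<open>r = 1\<close> the argument of \<open>N\<close> vanishes and
    \<open>- n x0\<close> remains; tilting the norm along \<open>x0\<close> thus gives a member of
    \<open>A\<close>.\<close>
  have "tilt x0 N (- x0) \<le> N (- x0 + scaleR' 1 x0) - 1 * N x0"
    by (intro tilt_le N x0 mem_neg) simp
  then have start: "tilt x0 N \<in> A"
    using sublinear_tilt[OF N x0] x0 by (simp add: A_def N_def)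
  have "\<exists>m\<in>A. \<forall>a\<in>A. P m a \<longrightarrow> a = m"
  proof (rule predicate_Zorn)
    show "partial_order_on A (relation_of P A)"
      by (rule partial_order_on_relation_ofI) (auto simp: P_def intro: order_trans intro!: antisym ext)
    fix C assume C: "C \<in> Chains (relation_of P A)"
    show "\<exists>u\<in>A. \<forall>a\<in>C. P a u"
    proof (cases "C = {}")
      case False
      have CA: "q \<in> A" if "q \<in> C" for q
        using C that by (auto simp: Chains_def relation_of_def)
      have Cs: "sublinear q" if "q \<in> C" for q
        using CA[OF that] by (simp add: A_def)
      have total: "P a b \<or> P b a" if "a \<in> C" "b \<in> C" for a b
        using C that by (auto simp: Chains_def relation_of_def)
      define u where "u = (\<lambda>x. INF q\<in>C. q x)"
      have le: "u x \<le> q x" if "q \<in> C" for q x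
        unfolding u_def
      proof (rule cINF_lower[OF _ that])
        have "(if x \<in> Y then - n x else 0) \<le> q x" if "q \<in> C" for q
          using sublinear_ge[OF Cs[OF that], of x] sublinearD(4)[OF Cs[OF that], of x] by simp
        then show "bdd_below ((\<lambda>q. q x) ` C)" by (rule bdd_belowI2)
      qed
      have approx: "\<exists>q\<in>C. q x < u x + e" if "e > 0" for x e
      proof (rule ccontr)
        assume "\<not> ?thesis"
        then have "u x + e \<le> u x"
          unfolding u_def using False by (intro cINF_greatest) (auto simp: not_less)
        with that show False by simp
      qed
      have "sublinear u"
      proof (rule sublinearI)
        fix x y assume xy: "x \<in> Y" "y \<in> Y"
        show "u (x + y) \<le> u x + u y"
        proof (rule field_le_epsilon)
          fix e :: real assume "e > 0"
          then have e: "e / 2 > 0" by simp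
          obtain q1 where q1: "q1 \<in> C" "q1 x < u x + e / 2" using approx[OF e] by blast
          obtain q2 where q2: "q2 \<in> C" "q2 y < u y + e / 2" using approx[OF e] by blast
          \<comment> \<open>Of two members of a chain the smaller one serves both arguments; here
            totality of the chain is essential.\<close>
          obtain q where q: "q \<in> C" "q x \<le> q1 x" "q y \<le> q2 y"
            using total[OF q1(1) q2(1)] q1 q2 by (auto simp: P_def)
          have "u (x + y) \<le> q x + q y"
            using le[OF q(1), of "x + y"] sublinearD(1)[OF Cs[OF q(1)] xy] by simp
          with q q1 q2 show "u (x + y) \<le> u x + u y + e" by simp
        qed
      next
        fix r :: real and x assume r: "r > 0" and x: "x \<in> Y"
        show "u (scaleR' r x) \<le> r * u x"
        proof (rule field_le_epsilon)
          fix e :: real assume "e > 0"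
          then have e: "e / r > 0" using r by simp
          obtain q where q: "q \<in> C" "q x < u x + e / r" using approx[OF e] by blast
          have "u (scaleR' r x) \<le> r * q x"
            using le[OF q(1), of "scaleR' r x"] sublinearD(2)[OF Cs[OF q(1)] r x] by simp
          also have "\<dots> \<le> r * (u x + e / r)" using q r by (intro mult_left_mono) auto
          finally show "u (scaleR' r x) \<le> r * u x + e" using r by (simp add: algebra_simps)
        qed
      next
        obtain q where q: "q \<in> C" using False by blast
        show "u x \<le> n x" if "x \<in> Y" for x
          using le[OF q, of x] sublinearD(3)[OF Cs[OF q] that] by simp
        show "u x = 0" if "x \<notin> Y" for x
        proof -
          have "u x = (INF q\<in>C. 0)"
            unfolding u_def by (intro INF_cong refl sublinearD(4)[OF Cs that])
          with False show ?thesis by simp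
        qed
      qed
      moreover obtain q where "q \<in> C" using False by blast
      then have "u (- x0) \<le> - n x0"
        using le[of q "- x0"] CA[of q] by (simp add: A_def)
      ultimately show ?thesis
        using le by (auto simp: A_def P_def)
    qed (use start in blast)
  qed
  then obtain \<phi> where \<phi>: "\<phi> \<in> A" and min: "\<And>a. a \<in> A \<Longrightarrow> (\<And>x. a x \<le> \<phi> x) \<Longrightarrow> a = \<phi>"
    unfolding P_def by blast
  have sub: "sublinear \<phi>" using \<phi> by (simp add: A_def)
  have tilt: "tilt z \<phi> = \<phi>" if z: "z \<in> Y" for z
  proof (rule min)
    show le: "tilt z \<phi> x \<le> \<phi> x" for x by (rule tilt_le_self[OF sub z])
    show "tilt z \<phi> \<in> A"
      using sublinear_tilt[OF sub z] le[of "- x0"] \<phi> by (simp add: A_def)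
  qed
  \<comment> \<open>The equation \<open>tilt y \<phi> = \<phi>\<close>, evaluated at
    \<open>x\<close> with \<open>r = 1\<close>, is the reverse of subadditivity.\<close>
  have add: "\<phi> (x + y) = \<phi> x + \<phi> y" if "x \<in> Y" "y \<in> Y" for x y
    using tilt_le[OF sub that(2,1), of 1] sublinearD(1)[OF sub that] tilt[OF that(2)] by simp
  have neg: "\<phi> (- x) = - \<phi> x" if "x \<in> Y" for x
    using add[OF that mem_neg[OF that]] sublinear_0[OF sub] by simp
  show thesis
  proof (rule that; (intro ballI allI)?)
    show "\<phi> (x + y) = \<phi> x + \<phi> y" if "x \<in> Y" "y \<in> Y" for x y using add[OF that] .
    show "\<phi> x \<le> n x" if "x \<in> Y" for x using sublinearD(3)[OF sub that] .
    show "\<phi> x0 = n x0"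
      using sublinearD(3)[OF sub x0] \<phi> neg[OF x0] by (simp add: A_def)
    show "\<phi> (scaleR' r x) = r * \<phi> x" if x: "x \<in> Y" for r x
    proof (cases "r \<ge> 0")
      case False
      have "\<phi> (scaleR' r x) = \<phi> (- scaleR' (- r) x)" by simp
      also have "\<dots> = - \<phi> (scaleR' (- r) x)" by (rule neg[OF mem_scale[OF x]])
      also have "\<phi> (scaleR' (- r) x) = - r * \<phi> x"
        using False by (intro sublinear_scale[OF sub _ x]) simp
      finally show ?thesis by simp
    qed (rule sublinear_scale[OF sub _ x])
  qed
qed

text \<open>The real-linear functional \<open>\<phi>\<close> is made linear over the scalar field by requiring
  \<open>inner (h x) c = \<phi> (sc (scalar_conj c) x)\<close> for all scalars \<open>c\<close>.\<close>

lemma norming_functional: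
  assumes x0: "x0 \<in> Y"
  obtains h where "h \<in> banach_dual sc Y n" "\<forall>x\<in>Y. norm (h x) \<le> n x" "norm (h x0) = n x0"
proof -
  obtain \<phi> where add_raw: "\<forall>x\<in>Y. \<forall>y\<in>Y. \<phi> (x + y) = \<phi> x + \<phi> y"
    and scale_raw: "\<forall>r. \<forall>x\<in>Y. \<phi> (scaleR' r x) = r * \<phi> x"
    and le_raw: "\<forall>x\<in>Y. \<phi> x \<le> n x" and x0_eq: "\<phi> x0 = n x0"
    by (rule real_norming_functional[OF x0])
  note add = add_raw[rule_format] and scale = scale_raw[rule_format] and le = le_raw[rule_format]
  \<comment> \<open>The vector whose inner products with the basis elements \<open>b\<close> are
    \<open>\<phi> (sc (scalar_conj b) x)\<close>; real linearity extends the prescription from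
    \<open>b\<close> to all scalars.\<close>
  define h where "h = (\<lambda>x. \<Sum>b\<in>Basis. \<phi> (sc (scalar_conj b) x) *\<^sub>R b)"
  have inner_h: "inner (h x) c = \<phi> (sc (scalar_conj c) x)" if x: "x \<in> Y" for x c
  proof -
    have lin: "linear (\<lambda>c. \<phi> (sc (scalar_conj c) x))"
    proof (rule linearI)
      fix a b :: 'k and r :: real
      show "\<phi> (sc (scalar_conj (a + b)) x) = \<phi> (sc (scalar_conj a) x) + \<phi> (sc (scalar_conj b) x)"
        by (simp add: linear_add[OF linear_scalar_conj] scale_left_distrib add mem_scale x)
      have "\<phi> (sc (scalar_conj (r *\<^sub>R a)) x) = \<phi> (scaleR' r (sc (scalar_conj a) x))"
        by (simp add: linear_scale[OF linear_scalar_conj]) (simp add: scaleR_conv_of_real)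
      also have "\<dots> = r * \<phi> (sc (scalar_conj a) x)"
        by (rule scale[OF mem_scale[OF x]])
      finally show "\<phi> (sc (scalar_conj (r *\<^sub>R a)) x) = r *\<^sub>R \<phi> (sc (scalar_conj a) x)"
        by simp
    qed
    have "\<phi> (sc (scalar_conj c) x) = \<phi> (sc (scalar_conj (\<Sum>b\<in>Basis. inner c b *\<^sub>R b)) x)"
      by (simp add: euclidean_representation)
    also have "\<dots> = (\<Sum>b\<in>Basis. inner c b *\<^sub>R \<phi> (sc (scalar_conj b) x))"
      by (simp add: linear_sum[OF lin] linear_scale[OF lin])
    finally have "\<phi> (sc (scalar_conj c) x) = (\<Sum>b\<in>Basis. inner c b *\<^sub>R \<phi> (sc (scalar_conj b) x))" .
    then show ?thesis
      by (simp add: h_def inner_sum_left inner_commute[of c] mult.commute)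
  qed
  have h_le: "norm (h x) \<le> n x" if x: "x \<in> Y" for x
  proof -
    \<comment> \<open>Testing with the scalar \<open>h x\<close> itself: conjugation preserves the
      norm, so one factor \<open>norm (h x)\<close> cancels and the bound of \<open>\<phi>\<close>
      passes to \<open>h\<close> without a constant.\<close>
    have "(norm (h x))\<^sup>2 = \<phi> (sc (scalar_conj (h x)) x)"
      by (simp add: inner_h[OF x, symmetric] power2_norm_eq_inner)
    also have "\<dots> \<le> norm (h x) * n x"
      using le[OF mem_scale[OF x]] norm_scale[OF x] by (metis norm_scalar_conj)
    finally show ?thesis
      using nonneg[OF x] by (cases "h x = 0") (auto simp: power2_eq_square)
  qed
  have "h \<in> banach_dual sc Y n"
    unfolding banach_dual_def operator_on_def
  proof (intro CollectI conjI ballI allI exI)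
    show "h (x + y) = h x + h y" if "x \<in> Y" "y \<in> Y" for x y
      by (rule vector_eq_rdot[THEN iffD1])
         (simp add: inner_h inner_add_left mem_add that scale_right_distrib add mem_scale)
    show "h (sc c x) = c * h x" if x: "x \<in> Y" for c x
      by (rule vector_eq_rdot[THEN iffD1])
         (simp add: inner_h inner_mult_scalar_conj mem_scale x scalar_conj_mult mult.commute)
    show "norm (h x) \<le> 1 * n x" if "x \<in> Y" for x
      using h_le[OF that] by simp
  qed auto
  moreover have "norm (h x0) = n x0"
  proof (rule antisym[OF h_le[OF x0]])
    have "n x0 = inner (h x0) 1" by (simp add: inner_h[OF x0] x0_eq)
    also have "\<dots> \<le> norm (h x0) * norm (1::'k)" by (rule norm_cauchy_schwarz)
    finally show "n x0 \<le> norm (h x0)" by simp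
  qed
  ultimately show thesis using h_le that by blast
qed

end

subsection \<open>Dual spaces\<close>

lemma banach_dualD:
  assumes "h \<in> banach_dual sc Y n"
  shows "x \<in> Y \<Longrightarrow> y \<in> Y \<Longrightarrow> h (x + y) = h x + h y"
    and "x \<in> Y \<Longrightarrow> h (sc c x) = c * h x"
  using assms by (auto simp: banach_dual_def operator_on_def)

lemma banach_dualI:
  assumes "\<And>x y. x \<in> Y \<Longrightarrow> y \<in> Y \<Longrightarrow> h (x + y) = h x + h y"
    and "\<And>c x. x \<in> Y \<Longrightarrow> h (sc c x) = c * h x"
    and "\<And>x. x \<in> Y \<Longrightarrow> norm (h x) \<le> C * n x"
  shows "h \<in> banach_dual sc Y n"
  unfolding banach_dual_def operator_on_def using assms by blast

section \<open>Maps that are linear on a subspace\<close>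

locale linear_map_on = A: vector_space sc1 + B: vector_space sc2
  for sc1 :: "'k::field \<Rightarrow> 'a::ab_group_add \<Rightarrow> 'a" and sc2 :: "'k \<Rightarrow> 'b::ab_group_add \<Rightarrow> 'b" +
  fixes D :: "'a set" and T :: "'a \<Rightarrow> 'b"
  assumes subspace_D: "A.subspace D"
    and add: "x \<in> D \<Longrightarrow> y \<in> D \<Longrightarrow> T (x + y) = T x + T y"
    and scale: "x \<in> D \<Longrightarrow> T (sc1 c x) = sc2 c (T x)"
begin

lemma zero [simp]: "T 0 = 0"
  using scale[of 0 0] A.subspace_0[OF subspace_D] by simp

lemma neg: "x \<in> D \<Longrightarrow> T (- x) = - T x"
  using scale[of x "-1"] by simp

lemma diff: "x \<in> D \<Longrightarrow> y \<in> D \<Longrightarrow> T (x - y) = T x - T y"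
  using add[of x "- y"] neg[of y] A.subspace_neg[OF subspace_D] by simp

lemma sum: "(\<And>i. i \<in> I \<Longrightarrow> u i \<in> D) \<Longrightarrow> T (\<Sum>i\<in>I. u i) = (\<Sum>i\<in>I. T (u i))"
  by (induction I rule: infinite_finite_induct)
     (simp_all add: add A.subspace_sum[OF subspace_D])

lemma sum_scale:
  "(\<And>i. i \<in> I \<Longrightarrow> u i \<in> D) \<Longrightarrow> T (\<Sum>i\<in>I. sc1 (c i) (u i)) = (\<Sum>i\<in>I. sc2 (c i) (T (u i)))"
  using sum[of I "\<lambda>i. sc1 (c i) (u i)"] scale A.subspace_scale[OF subspace_D] by simp

end

lemma vector_space_mult: "vector_space ((*) :: 'k::field \<Rightarrow> 'k \<Rightarrow> 'k)"
  by unfold_locales (auto simp: algebra_simps)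

lemma vector_space_fun_scale: "vector_space (fun_scale :: 'k::field \<Rightarrow> ('i \<Rightarrow> 'k) \<Rightarrow> _)"
  by unfold_locales (auto simp: fun_scale_def algebra_simps)

lemma sum_fun_apply: "(\<Sum>i\<in>I. u i) x = (\<Sum>i\<in>I. u i x)"
  by (induction I rule: infinite_finite_induct) auto

context normed_subspace
begin

lemma dual_linear: "h \<in> banach_dual sc Y n \<Longrightarrow> linear_map_on sc (*) Y h"
  by (intro linear_map_on.intro linear_map_on_axioms.intro vector_space_axioms vector_space_mult)
     (auto simp: subspace_Y banach_dualD)

lemma bdd_above_dual:
  assumes "h \<in> banach_dual sc Y n"
  shows "bdd_above ((\<lambda>y. norm (h y)) ` {y\<in>Y. n y \<le> 1})"
proof -
  obtain C where C: "\<And>y. y \<in> Y \<Longrightarrow> norm (h y) \<le> C * n y"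
    using assms by (auto simp: banach_dual_def)
  have "norm (h y) \<le> \<bar>C\<bar>" if "y \<in> Y" "n y \<le> 1" for y
  proof -
    have "norm (h y) \<le> \<bar>C\<bar> * n y"
      using C[OF that(1)] mult_right_mono[OF abs_ge_self nonneg[OF that(1)], of C] by linarith
    also have "\<dots> \<le> \<bar>C\<bar> * 1" by (intro mult_left_mono that) simp
    finally show ?thesis by simp
  qed
  then show ?thesis by (intro bdd_aboveI2) auto
qed

lemma dual_norm_nonneg:
  assumes "h \<in> banach_dual sc Y n"
  shows "0 \<le> dual_norm Y n h"
  unfolding dual_norm_def
  by (rule cSUP_upper2[OF bdd_above_dual[OF assms], of 0]) auto

lemma norm_le_dual_norm:
  assumes h: "h \<in> banach_dual sc Y n" and x: "x \<in> Y"
  shows "norm (h x) \<le> dual_norm Y n h * n x"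
proof (cases "x = 0")
  case True
  interpret linear_map_on sc "(*)" Y h by (rule dual_linear[OF h])
  from True show ?thesis by simp
next
  case False
  then have pos: "n x > 0" using nonneg[OF x] eq_0_iff[OF x] by simp
  let ?y = "sc (of_real (1 / n x)) x"
  have "norm (h ?y) \<le> dual_norm Y n h"
    unfolding dual_norm_def
    by (rule cSUP_upper[OF _ bdd_above_dual[OF h]])
       (use pos in \<open>simp add: mem_scale x norm_scale norm_divide\<close>)
  then have "norm (h x) / n x \<le> dual_norm Y n h"
    using pos by (simp add: banach_dualD(2)[OF h x] norm_mult norm_divide)
  with pos show ?thesis by (simp add: pos_divide_le_eq)
qed

lemma dual_norm_le:
  assumes "\<And>x. x \<in> Y \<Longrightarrow> norm (h x) \<le> C * n x" "C \<ge> 0"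
  shows "dual_norm Y n h \<le> C"
  unfolding dual_norm_def
proof (rule cSUP_least)
  show "{y \<in> Y. n y \<le> 1} \<noteq> {}" using mem_0 norm_0 by (metis (mono_tags, lifting) empty_iff mem_Collect_eq zero_le_one)
  fix x assume "x \<in> {y \<in> Y. n y \<le> 1}"
  then have "norm (h x) \<le> C * n x" "C * n x \<le> C * 1"
    using assms by (blast, intro mult_left_mono) auto
  then show "norm (h x) \<le> C" by simp
qed

lemma dual_norm_cong: "(\<And>x. x \<in> Y \<Longrightarrow> h x = h' x) \<Longrightarrow> dual_norm Y n h = dual_norm Y n h'"
  unfolding dual_norm_def by (rule arg_cong[where f = Sup]) (auto intro!: image_cong)

lemma dual_limit:
  assumes h: "h \<in> banach_dual sc Y n" and "\<And>m. u m \<in> Y" "l \<in> Y"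
    and lim: "(\<lambda>m. n (u m - l)) \<longlonglongrightarrow> 0"
  shows "(\<lambda>m. h (u m)) \<longlonglongrightarrow> h l"
proof -
  interpret linear_map_on sc "(*)" Y h by (rule dual_linear[OF h])
  have "(\<lambda>m. h (u m) - h l) \<longlonglongrightarrow> 0"
  proof (rule Lim_null_comparison)
    show "\<forall>\<^sub>F m in sequentially. norm (h (u m) - h l) \<le> dual_norm Y n h * n (u m - l)"
      using norm_le_dual_norm[OF h mem_diff[OF assms(2,3)]] diff[OF assms(2,3)] by simp
    show "(\<lambda>m. dual_norm Y n h * n (u m - l)) \<longlonglongrightarrow> 0"
      using tendsto_mult_right_zero[OF lim] .
  qed
  then show ?thesis by (simp add: LIM_zero_iff)
qed

section \<open>Approximation by dense subspaces and extension from them\<close>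

lemma dense_sequence:
  assumes dense: "norm_topology Y n closure_of D = Y" and x: "x \<in> Y"
  obtains y where "\<forall>j. y j \<in> D" "\<forall>j. y j \<in> Y" "(\<lambda>j. n (y j - x)) \<longlonglongrightarrow> 0"
proof -
  have "\<forall>j. \<exists>y. y \<in> D \<and> y \<in> Y \<and> n (y - x) < 1 / Suc j"
  proof
    fix j
    have "1 / real (Suc j) > 0" by simp
    from dense_approx[OF dense x this]
    show "\<exists>y. y \<in> D \<and> y \<in> Y \<and> n (y - x) < 1 / Suc j" by blast
  qed
  from choice[OF this] obtain y where
    y: "\<And>j. y j \<in> D" "\<And>j. y j \<in> Y" "\<And>j. n (y j - x) < 1 / Suc j" by blast
  have "(\<lambda>j. n (y j - x)) \<longlonglongrightarrow> 0"
    by (rule tendsto_sandwich[OF _ _ tendsto_const LIMSEQ_inverse_real_of_nat])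
       (use y(3) nonneg[OF mem_diff[OF y(2) x]] in \<open>auto simp: inverse_eq_divide less_imp_le\<close>)
  with y(1,2) show thesis by (intro that[of y]) simp_all
qed

lemma convergent_imp_Cauchy:
  assumes y: "\<And>j. y j \<in> Y" and x: "x \<in> Y"
    and lim: "(\<lambda>j. n (y j - x)) \<longlonglongrightarrow> 0" and e: "e > 0"
  shows "\<exists>M. \<forall>i\<ge>M. \<forall>j\<ge>M. n (y i - y j) < e"
proof -
  have "e / 2 > 0" using e by simp
  then have "\<forall>\<^sub>F j in sequentially. n (y j - x) < e / 2"
    by (rule order_tendstoD(2)[OF lim])
  then obtain M where M: "\<And>j. j \<ge> M \<Longrightarrow> n (y j - x) < e / 2"
    by (auto simp: eventually_sequentially)
  have "n (y i - y j) < e" if ij: "i \<ge> M" "j \<ge> M" for i j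
    using triangle_via[OF y x y, of i j] norm_diff_commute[OF x y, of j] M[OF ij(1)] M[OF ij(2)] by simp
  then show ?thesis by blast
qed

text \<open>The extended value at \<open>x\<close> is the only scalar \<open>z\<close> with \<open>norm (h y - z) \<le> C * n (y - x)\<close>
  for all \<open>y\<close> in the dense subspace.\<close>

lemma dense_extension:
  assumes dense: "norm_topology Y n closure_of D = Y"
    and D: "subspace D" "D \<subseteq> Y"
    and add: "\<And>x y. x \<in> D \<Longrightarrow> y \<in> D \<Longrightarrow> h (x + y) = h x + h y"
    and scale: "\<And>c x. x \<in> D \<Longrightarrow> h (sc c x) = c * h x"
    and bound: "\<And>x. x \<in> D \<Longrightarrow> norm (h x) \<le> C * n x" and "C \<ge> 0"
  obtains h' where "h' \<in> banach_dual sc Y n" "\<forall>x\<in>D. h' x = h x"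
    "\<forall>x\<in>Y. norm (h' x) \<le> C * n x"
proof -
  interpret h: linear_map_on sc "(*)" D h
    by (intro linear_map_on.intro linear_map_on_axioms.intro vector_space_axioms vector_space_mult D(1) add scale)
  have near: "\<exists>y\<in>D. n (y - x) < e" if "x \<in> Y" "e > 0" for x e
    using dense_approx[OF dense that] by blast
  have lip: "norm (h y - h z) \<le> C * n (y - z)" if "y \<in> D" "z \<in> D" for y z
    using bound[of "y - z"] h.diff[OF that] that subspace_diff[OF D(1)] by simp
  have ex: "\<exists>z. \<forall>y\<in>D. norm (h y - z) \<le> C * n (y - x)" if x: "x \<in> Y" for x
  proof -
    obtain y where "\<forall>j. y j \<in> D" "\<forall>j. y j \<in> Y" and lim: "(\<lambda>j. n (y j - x)) \<longlonglongrightarrow> 0"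
      by (rule dense_sequence[OF dense x])
    then have y: "y j \<in> D" and yY: "y j \<in> Y" for j by simp_all
    have "Cauchy (\<lambda>j. h (y j))"
    proof (rule metric_CauchyI)
      fix e :: real assume "e > 0"
      then have "e / (C + 1) > 0" using \<open>C \<ge> 0\<close> by simp
      then obtain M where M: "\<forall>i\<ge>M. \<forall>j\<ge>M. n (y i - y j) < e / (C + 1)"
        using convergent_imp_Cauchy[OF yY x lim] by blast
      show "\<exists>M. \<forall>i\<ge>M. \<forall>j\<ge>M. dist (h (y i)) (h (y j)) < e"
      proof (intro exI allI impI)
        fix i j assume ij: "i \<ge> M" "j \<ge> M"
        have "norm (h (y i) - h (y j)) \<le> C * n (y i - y j)"
          by (intro lip y)
        also have "\<dots> \<le> C * (e / (C + 1))"
          by (rule mult_left_mono[OF less_imp_le \<open>C \<ge> 0\<close>]) (use M ij in blast)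
        also have "\<dots> < e" using \<open>C \<ge> 0\<close> \<open>e > 0\<close> by (simp add: field_simps)
        finally show "dist (h (y i)) (h (y j)) < e" by (simp add: dist_norm)
      qed
    qed
    then obtain z where z: "(\<lambda>j. h (y j)) \<longlonglongrightarrow> z"
      using Cauchy_convergent convergent_def by blast
    have "norm (h v - z) \<le> C * n (v - x)" if v: "v \<in> D" for v
    proof (rule LIMSEQ_le)
      show "(\<lambda>j. norm (h v - h (y j))) \<longlonglongrightarrow> norm (h v - z)"
        by (intro tendsto_intros z)
      show "(\<lambda>j. C * (n (v - x) + n (y j - x))) \<longlonglongrightarrow> C * n (v - x)"
        using lim by (auto intro!: tendsto_eq_intros)
      have "norm (h v - h (y j)) \<le> C * (n (v - x) + n (y j - x))" for j
      proof -
        have "norm (h v - h (y j)) \<le> C * n (v - y j)" by (intro lip v y)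
        also have "\<dots> \<le> C * (n (v - x) + n (y j - x))"
          using triangle_via[of v x "y j"] norm_diff_commute[OF x yY, of j] v D(2) x yY \<open>C \<ge> 0\<close>
          by (intro mult_left_mono) auto
        finally show ?thesis .
      qed
      then show "\<exists>N. \<forall>j\<ge>N. norm (h v - h (y j)) \<le> C * (n (v - x) + n (y j - x))" by blast
    qed
    then show ?thesis by blast
  qed
  define h' where "h' = (\<lambda>x. SOME z. \<forall>y\<in>D. norm (h y - z) \<le> C * n (y - x))"
  have h': "norm (h y - h' x) \<le> C * n (y - x)" if "x \<in> Y" "y \<in> D" for x y
    using someI_ex[OF ex[OF that(1)]] that(2) unfolding h'_def by blast
  have eq: "h' x = h x" if "x \<in> D" for x
    using h'[of x x] that D(2) by auto
  have h'_add: "h' (x + y) = h' x + h' y" if xy: "x \<in> Y" "y \<in> Y" for x y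
  proof -
    \<comment> \<open>The factor 4 arises because each of the two approximation errors counts twice:
      once for its own summand and once for the approximation of \<open>x + y\<close> by
      \<open>x' + y'\<close>.\<close>
    have "norm (h' (x + y) - (h' x + h' y)) \<le> (4 * C) * e" if e: "e > 0" for e
    proof -
      obtain x' where x': "x' \<in> D" "n (x' - x) < e" using near[OF xy(1) e] by blast
      obtain y' where y': "y' \<in> D" "n (y' - y) < e" using near[OF xy(2) e] by blast
      have Y: "x' \<in> Y" "y' \<in> Y" "x' + y' \<in> D"
        using x' y' D subspace_add[OF D(1)] by auto
      have "h' (x + y) - (h' x + h' y)
          = (h x' - h' x) + (h y' - h' y) - (h (x' + y') - h' (x + y))"
        using add[OF x'(1) y'(1)] by simp
      also have "norm \<dots> \<le> norm (h x' - h' x) + norm (h y' - h' y) + norm (h (x' + y') - h' (x + y))"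
        by (rule order_trans[OF norm_triangle_ineq4 add_right_mono[OF norm_triangle_ineq]])
      also have "\<dots> \<le> C * n (x' - x) + C * n (y' - y) + C * n ((x' + y') - (x + y))"
        by (intro add_mono h' xy x' y' Y mem_add)
      also have "\<dots> \<le> C * n (x' - x) + C * n (y' - y) + C * (n (x' - x) + n (y' - y))"
      proof -
        have "(x' + y') - (x + y) = (x' - x) + (y' - y)" by simp
        then have "n ((x' + y') - (x + y)) \<le> n (x' - x) + n (y' - y)"
          using triangle[of "x' - x" "y' - y"] mem_diff Y xy by metis
        then show ?thesis using \<open>C \<ge> 0\<close> by (intro add_left_mono mult_left_mono)
      qed
      also have "\<dots> = (2 * C) * (n (x' - x) + n (y' - y))" by (simp add: algebra_simps)
      also have "\<dots> \<le> (2 * C) * (e + e)"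
        using x' y' \<open>C \<ge> 0\<close> by (intro mult_left_mono) auto
      finally show ?thesis by simp
    qed
    then have "norm (h' (x + y) - (h' x + h' y)) \<le> 0"
      using \<open>C \<ge> 0\<close> by (intro le_zero_if_le_mult_epsilon[of "4 * C"]) (auto simp del: norm_le_zero_iff)
    then show ?thesis by simp
  qed
  have h'_scale: "h' (sc c x) = c * h' x" if x: "x \<in> Y" for c x
  proof -
    have "norm (h' (sc c x) - c * h' x) \<le> (2 * C * norm c) * e" if e: "e > 0" for e
    proof -
      obtain y where y: "y \<in> D" "n (y - x) < e" using near[OF x e] by blast
      then have Y: "y \<in> Y" "sc c y \<in> D" using D subspace_scale[OF D(1)] by auto
      have "h' (sc c x) - c * h' x = c * (h y - h' x) - (h (sc c y) - h' (sc c x))"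
        using scale[OF y(1)] by (simp add: algebra_simps)
      also have "norm \<dots> \<le> norm c * norm (h y - h' x) + norm (h (sc c y) - h' (sc c x))"
        using norm_triangle_ineq4[of "c * (h y - h' x)"] by (simp add: norm_mult)
      also have "\<dots> \<le> norm c * (C * n (y - x)) + C * n (sc c y - sc c x)"
        by (intro add_mono mult_left_mono h' x y Y mem_scale) auto
      also have "\<dots> = (2 * C * norm c) * n (y - x)"
        using norm_scale[of "y - x" c] mem_diff[OF Y(1) x] by (simp add: scale_right_diff_distrib)
      also have "\<dots> \<le> (2 * C * norm c) * e"
        using y \<open>C \<ge> 0\<close> by (intro mult_left_mono) auto
      finally show ?thesis .
    qed
    then have "norm (h' (sc c x) - c * h' x) \<le> 0"
      using \<open>C \<ge> 0\<close> by (intro le_zero_if_le_mult_epsilon[of "2 * C * norm c"]) (auto simp del: norm_le_zero_iff)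
    then show ?thesis by simp
  qed
  \<comment> \<open>The defining estimate of \<open>h' x\<close> at the point 0 of \<open>D\<close>
    is already the norm bound.\<close>
  have h'_le: "norm (h' x) \<le> C * n x" if x: "x \<in> Y" for x
    using h'[OF x subspace_0[OF D(1)]] norm_neg[OF x] by simp
  show thesis
    by (rule that[OF banach_dualI[of Y h' sc C]]) (auto simp: h'_add h'_scale h'_le eq)
qed

end

subsection \<open>Sequence spaces and admissible scales\<close>

lemma CB_normed_subspace:
  assumes "CB_space \<Theta> n"
  shows "normed_subspace fun_scale \<Theta> n"
  using assms
  by (intro normed_subspace.intro normed_subspace_axioms.intro vector_space_fun_scale)
     (auto simp: CB_space_def BK_space_def banach_on_def)

lemma CB_unit_seq: "CB_space \<Theta> n \<Longrightarrow> unit_seq i \<in> \<Theta>"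
  by (simp add: CB_space_def schauder_basis_def)

text \<open>The closed form of the \<open>N\<close>-th partial sum in the unit vectors, with the
  coordinates below \<open>N\<close> retained. It lies in every CB-space even when \<open>d\<close>
  does not, so truncations can be used in all \<open>\<Theta> k\<close> at once.\<close>

definition truncate :: "nat \<Rightarrow> (nat \<Rightarrow> 'k::zero) \<Rightarrow> nat \<Rightarrow> 'k" where
  "truncate N d = (\<lambda>i. if i < N then d i else 0)"

lemma sum_unit_seq: "(\<Sum>i<N. fun_scale (d i) (unit_seq i)) = truncate N (d :: nat \<Rightarrow> 'k::field)"
proof
  fix j
  have "(\<Sum>i<N. fun_scale (d i) (unit_seq i)) j = (\<Sum>i<N. if j = i then d i else 0)"
    unfolding sum_fun_apply by (rule sum.cong) (auto simp: fun_scale_def unit_seq_def)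
  then show "(\<Sum>i<N. fun_scale (d i) (unit_seq i)) j = truncate N d j"
    by (simp add: truncate_def)
qed

lemma CB_truncate_mem:
  assumes "CB_space \<Theta> n"
  shows "truncate N d \<in> \<Theta>"
proof -
  interpret normed_subspace fun_scale \<Theta> n by (rule CB_normed_subspace[OF assms])
  show ?thesis
    unfolding sum_unit_seq[symmetric] by (intro mem_sum mem_scale CB_unit_seq[OF assms])
qed

text \<open>The coefficients of the basis expansion are identified by the coordinate functionals.\<close>

lemma CB_expansion:
  assumes CB: "CB_space \<Theta> n" and d: "d \<in> \<Theta>"
  shows "(\<lambda>N. n (truncate N d - d)) \<longlonglongrightarrow> 0"
proof -
  interpret normed_subspace fun_scale \<Theta> n by (rule CB_normed_subspace[OF CB])
  obtain c where "series_in (norm_topology \<Theta> n) (\<lambda>i. fun_scale (c i) (unit_seq i)) d"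
    using CB d by (auto simp: CB_space_def schauder_basis_def)
  then have lim: "(\<lambda>N. n (truncate N c - d)) \<longlonglongrightarrow> 0"
    by (simp add: series_in_def limitin_norm sum_unit_seq)
  have "c j = d j" for j
  proof -
    have "(\<lambda>d. d j) \<in> banach_dual fun_scale \<Theta> n"
      using CB by (simp add: CB_space_def BK_space_def)
    from dual_limit[OF this CB_truncate_mem[OF CB] d lim]
    have "(\<lambda>N. truncate N c j) \<longlonglongrightarrow> d j" .
    moreover have "(\<lambda>N. truncate N c j) \<longlonglongrightarrow> c j"
      by (rule tendsto_eventually)
         (use eventually_gt_at_top[of j] in eventually_elim, simp add: truncate_def)
    ultimately show ?thesis using LIMSEQ_unique by blast
  qed
  then have "c = d" by blast
  with lim show ?thesis by simp
qed

lemma CB_dual_truncate: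
  assumes CB: "CB_space \<Theta> n" and h: "h \<in> banach_dual fun_scale \<Theta> n"
  shows "h (truncate N d) = (\<Sum>i<N. d i * h (unit_seq i))"
proof -
  interpret normed_subspace fun_scale \<Theta> n by (rule CB_normed_subspace[OF CB])
  interpret h: linear_map_on fun_scale "(*)" \<Theta> h by (rule dual_linear[OF h])
  show ?thesis
    unfolding sum_unit_seq[symmetric] by (rule h.sum_scale) (rule CB_unit_seq[OF CB])
qed

text \<open>A functional on a CB-space is determined by its values at the unit vectors. This
  justifies the sequence model of the dual and lets two descriptions of a functional be compared
  coefficient by coefficient.\<close>

lemma CB_dual_expansion:
  assumes CB: "CB_space \<Theta> n" and h: "h \<in> banach_dual fun_scale \<Theta> n" and d: "d \<in> \<Theta>"
  shows "(\<lambda>N. \<Sum>i<N. d i * h (unit_seq i)) \<longlonglongrightarrow> h d"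
proof -
  interpret normed_subspace fun_scale \<Theta> n by (rule CB_normed_subspace[OF CB])
  show ?thesis
    using dual_limit[OF h CB_truncate_mem[OF CB] d CB_expansion[OF CB d]]
    unfolding CB_dual_truncate[OF CB h] .
qed

text \<open>The definite description is met because two functionals representing the same sequence
  agree on \<open>\<Theta>\<close> by their basis expansions. They may differ off
  \<open>\<Theta>\<close>, but the dual norm does not see those values.\<close>

lemma seq_dual_norm_eq:
  assumes CB: "CB_space \<Theta> n" and h: "h \<in> banach_dual fun_scale \<Theta> n"
  shows "seq_dual_norm \<Theta> n (\<lambda>i. h (unit_seq i)) = dual_norm \<Theta> n h"
  unfolding seq_dual_norm_def
proof (rule the_equality)
  interpret normed_subspace fun_scale \<Theta> n by (rule CB_normed_subspace[OF CB])
  fix r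
  assume "\<exists>h'\<in>banach_dual fun_scale \<Theta> n.
    (\<lambda>i. h (unit_seq i)) = (\<lambda>i. h' (unit_seq i)) \<and> r = dual_norm \<Theta> n h'"
  then obtain h' where h': "h' \<in> banach_dual fun_scale \<Theta> n" "r = dual_norm \<Theta> n h'"
    and eq: "(\<lambda>i. h (unit_seq i)) = (\<lambda>i. h' (unit_seq i))" by blast
  have "h' d = h d" if "d \<in> \<Theta>" for d
    using CB_dual_expansion[OF CB h that] CB_dual_expansion[OF CB h'(1) that]
    unfolding fun_cong[OF eq] by (rule LIMSEQ_unique[rotated])
  then show "r = dual_norm \<Theta> n h"
    unfolding h'(2) by (rule dual_norm_cong)
qed (use h in blast)

section \<open>The Frechet space of an admissible scale\<close>

locale scale_space = vector_space sc
  for sc :: "'k::{real_normed_field,euclidean_space} \<Rightarrow> 'a::ab_group_add \<Rightarrow> 'a" +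
  fixes Y :: "nat \<Rightarrow> 'a set" and n :: "nat \<Rightarrow> 'a \<Rightarrow> real"
  assumes admissible: "admissible_scale sc Y n"
begin

sublocale S: normed_subspace sc "Y r" "n r" for r
  by unfold_locales (use admissible in \<open>unfold admissible_scale_def banach_on_def, blast\<close>)

abbreviation YF :: "'a set" where "YF \<equiv> \<Inter>r. Y r"

lemma complete: "Metric_space.mcomplete (Y r) (norm_dist (Y r) (n r))"
  using admissible[unfolded admissible_scale_def, THEN conjunct1, THEN spec, of r]
  by (simp add: banach_on_def)

lemma dense: "norm_topology (Y r) (n r) closure_of YF = Y r"
  using admissible unfolding admissible_scale_def by (elim conjE allE[of _ r])

lemma Y_antimono: "r \<le> r' \<Longrightarrow> Y r' \<subseteq> Y r"
proof (rule lift_Suc_antimono_le[of Y])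
  show "Y (Suc r) \<subseteq> Y r" for r
    using admissible unfolding admissible_scale_def by blast
qed

lemma n_mono: "r \<le> r' \<Longrightarrow> x \<in> Y r' \<Longrightarrow> n r x \<le> n r' x"
proof (induction r' rule: dec_induct)
  case (step m)
  have "x \<in> Y m" using Y_antimono[of m "Suc m"] step.prems by auto
  moreover have "n m x \<le> n (Suc m) x"
    using admissible step.prems unfolding admissible_scale_def by blast
  ultimately show ?case using step.IH by simp
qed simp

lemma subspace_YF: "subspace YF"
  by (rule subspace_Inter, rule ballI, elim rangeE, simp only: S.subspace_Y)

lemma YF_subset: "YF \<subseteq> Y r" by blast

lemma limitin_frechet:
  "limitin (frechet_topology Y n) u l F \<longleftrightarrow>
     l \<in> YF \<and> (\<forall>\<^sub>F m in F. u m \<in> YF) \<and> (\<forall>r. ((\<lambda>m. n r (u m - l)) \<longlongrightarrow> 0) F)"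
proof -
  have "limitin (frechet_topology Y n) u l F \<longleftrightarrow>
     l \<in> YF \<and> (\<forall>\<^sub>F m in F. u m \<in> YF) \<and> (\<forall>p\<in>range n. ((\<lambda>m. p (u m - l)) \<longlongrightarrow> 0) F)"
    unfolding frechet_topology_def
  proof (rule limitin_seminorm_topology)
    fix p x y z assume p: "p \<in> range n" and xyz: "x \<in> YF" "y \<in> YF" "z \<in> YF"
    from p obtain r where r: "p = n r" by blast
    show "p (x - z) \<le> p (x - y) + p (y - z)"
      unfolding r by (rule S.triangle_via) (use xyz in auto)
  next
    fix p x y assume p: "p \<in> range n" and xy: "x \<in> YF" "y \<in> YF"
    from p obtain r where r: "p = n r" by blast
    show "0 \<le> p (x - y)"
      unfolding r by (rule S.nonneg, rule S.mem_diff) (use xy in auto)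
  qed auto
  then show ?thesis by simp
qed

text \<open>The norms increase with the index, and some \<open>s k\<close> exceeds any given
  \<open>r\<close>. The estimates of the frame concern only the indices \<open>s k\<close>; this
  passes from them to all norms.\<close>

lemma limit_cofinal:
  assumes s: "filterlim s at_top sequentially"
    and "\<And>m. u m \<in> YF" "l \<in> YF"
    and lim: "\<And>k. (\<lambda>m. n (s k) (u m - l)) \<longlonglongrightarrow> 0"
  shows "(\<lambda>m. n r (u m - l)) \<longlonglongrightarrow> 0"
proof -
  have "\<forall>\<^sub>F k in sequentially. r \<le> s k"
    using s by (auto simp: filterlim_at_top)
  then obtain k where k: "r \<le> s k" by (auto simp: eventually_sequentially)
  have mem: "u m - l \<in> Y q" for m q using assms(2,3) by (auto intro: S.mem_diff)
  show ?thesis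
    by (rule tendsto_sandwich[OF _ _ tendsto_const lim[of k]])
       (use S.nonneg[OF mem] n_mono[OF k mem] in auto)
qed

text \<open>Each Banach space \<open>Y r\<close> supplies its own limit. All of them are limits in
  the weakest norm as well, where limits are unique, so they are one element of the
  intersection.\<close>

lemma frechet_complete:
  assumes s: "filterlim s at_top sequentially"
    and u: "\<And>m. u m \<in> YF"
    and Cauchy: "\<And>k e. e > 0 \<Longrightarrow> \<exists>N. \<forall>i\<ge>N. \<forall>j\<ge>N. n (s k) (u i - u j) < e"
  obtains l where "l \<in> YF" "\<forall>r. (\<lambda>m. n r (u m - l)) \<longlonglongrightarrow> 0"
proof -
  have uY: "u m \<in> Y r" for m r using u by blast
  have "\<exists>l. l \<in> Y r \<and> (\<lambda>m. n r (u m - l)) \<longlonglongrightarrow> 0" for r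
  proof -
    have "\<forall>\<^sub>F k in sequentially. r \<le> s k"
      using s by (auto simp: filterlim_at_top)
    then obtain k where k: "r \<le> s k" by (auto simp: eventually_sequentially)
    have "\<exists>N. \<forall>i\<ge>N. \<forall>j\<ge>N. n r (u i - u j) < e" if e: "e > 0" for e
    proof -
      obtain N where "\<forall>i\<ge>N. \<forall>j\<ge>N. n (s k) (u i - u j) < e" using Cauchy[OF e] by blast
      then have "\<forall>i\<ge>N. \<forall>j\<ge>N. n r (u i - u j) < e"
        by (intro allI impI le_less_trans[OF n_mono[OF k S.mem_diff[OF uY uY]]]) auto
      then show ?thesis ..
    qed
    from S.Cauchy_limit[OF complete uY this] show ?thesis by blast
  qed
  then have "\<forall>r. \<exists>l. l \<in> Y r \<and> (\<lambda>m. n r (u m - l)) \<longlonglongrightarrow> 0" ..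
  from choice[OF this] obtain l where
    l: "\<And>r. l r \<in> Y r" "\<And>r. (\<lambda>m. n r (u m - l r)) \<longlonglongrightarrow> 0" by blast
  have l0: "l r = l 0" for r
  proof (rule S.limit_unique[of u 0])
    have lY: "l r \<in> Y 0" using l(1)[of r] Y_antimono[of 0 r] by auto
    show "(\<lambda>m. n 0 (u m - l r)) \<longlonglongrightarrow> 0"
      by (rule tendsto_sandwich[OF _ _ tendsto_const l(2)[of r]])
         (use S.nonneg[OF S.mem_diff[OF uY lY]] n_mono[OF _ S.mem_diff[OF uY l(1)], of 0] in auto)
    show "l r \<in> Y 0" by (rule lY)
  qed (use uY l in auto)
  show thesis
  proof (rule that)
    show "l 0 \<in> YF"
    proof
      fix r show "l 0 \<in> Y r" using l(1)[of r] unfolding l0[of r] .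
    qed
    show "\<forall>r. (\<lambda>m. n r (u m - l 0)) \<longlonglongrightarrow> 0"
    proof
      fix r show "(\<lambda>m. n r (u m - l 0)) \<longlonglongrightarrow> 0" using l(2)[of r] unfolding l0[of r] .
    qed
  qed
qed

lemma frechet_dual_linear:
  assumes "h \<in> frechet_dual sc Y n"
  shows "linear_map_on sc (*) YF h"
proof (intro linear_map_on.intro linear_map_on_axioms.intro vector_space_axioms vector_space_mult subspace_YF)
  have h: "operator_on sc (*) YF UNIV h" using assms by (simp add: frechet_dual_def)
  show "h (x + y) = h x + h y" if "x \<in> YF" "y \<in> YF" for x y
    using h that unfolding operator_on_def by blast
  show "h (sc c x) = c * h x" if "x \<in> YF" for c x
    using h that unfolding operator_on_def by blast
qed

lemma frechet_dual_combination:
  fixes g :: "nat \<Rightarrow> 'a \<Rightarrow> 'k"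
  assumes "\<And>i. g i \<in> frechet_dual sc Y n"
  shows "(\<Sum>i<N. fun_scale (c i) (g i)) \<in> frechet_dual sc Y n"
proof -
  have eq: "(\<Sum>i<N. fun_scale (c i) (g i)) = (\<lambda>x. \<Sum>i<N. c i * g i x)"
    by (auto simp: sum_fun_apply fun_scale_def)
  have cont: "continuous_map (frechet_topology Y n) euclidean (\<lambda>x. \<Sum>i<N. c i * g i x)"
  proof (intro continuous_map_sum finite_lessThan)
    fix i
    have "continuous_map (frechet_topology Y n) euclidean ((\<lambda>z. c i * z) \<circ> g i)"
    proof (rule continuous_map_compose)
      show "continuous_map (frechet_topology Y n) euclidean (g i)"
        using assms[of i] by (simp add: frechet_dual_def)
      show "continuous_map euclidean euclidean (\<lambda>z. c i * z)"
        unfolding continuous_map_iff_continuous2 by (intro continuous_intros)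
    qed
    then show "continuous_map (frechet_topology Y n) euclidean (\<lambda>x. c i * g i x)"
      by (simp add: comp_def)
  qed
  have "operator_on sc (*) YF UNIV (\<lambda>x. \<Sum>i<N. c i * g i x)"
    using linear_map_on.add[OF frechet_dual_linear[OF assms]]
      linear_map_on.scale[OF frechet_dual_linear[OF assms]]
    by (simp add: operator_on_def sum.distrib distrib_left sum_distrib_left mult.left_commute)
  with cont show ?thesis unfolding eq frechet_dual_def by blast
qed

lemma limitin_weak_star:
  "limitin (weak_star_topology sc Y n) u h F \<longleftrightarrow>
     h \<in> frechet_dual sc Y n \<and> (\<forall>\<^sub>F m in F. u m \<in> frechet_dual sc Y n) \<and>
     (\<forall>x\<in>YF. ((\<lambda>m. u m x) \<longlongrightarrow> h x) F)"
proof -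
  let ?P = "(\<lambda>x h :: 'a \<Rightarrow> 'k. norm (h x)) ` YF"
  have "limitin (weak_star_topology sc Y n) u h F \<longleftrightarrow>
     h \<in> frechet_dual sc Y n \<and> (\<forall>\<^sub>F m in F. u m \<in> frechet_dual sc Y n) \<and>
     (\<forall>p\<in>?P. ((\<lambda>m. p (u m - h)) \<longlongrightarrow> 0) F)"
    unfolding weak_star_topology_def setcompr_eq_image Collect_mem_eq
  proof (rule limitin_seminorm_topology)
    have "0 \<in> YF" by (rule subspace_0[OF subspace_YF])
    then show "?P \<noteq> {}" unfolding image_is_empty by (rule ex_in_conv[THEN iffD1, OF exI])
    fix p :: "('a \<Rightarrow> 'k) \<Rightarrow> real" and x y z :: "'a \<Rightarrow> 'k" assume "p \<in> ?P"
    then obtain w where p: "p = (\<lambda>h. norm (h w))" by (rule imageE)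
    show "p (x - z) \<le> p (x - y) + p (y - z)"
      using dist_triangle[of "x w" "z w" "y w"] unfolding p by (simp add: dist_norm)
    show "0 \<le> p (x - y)" unfolding p by simp
    show "p 0 = 0" unfolding p by simp
  qed
  also have "\<dots> \<longleftrightarrow> h \<in> frechet_dual sc Y n \<and> (\<forall>\<^sub>F m in F. u m \<in> frechet_dual sc Y n) \<and>
     (\<forall>x\<in>YF. ((\<lambda>m. u m x) \<longlongrightarrow> h x) F)"
    by (simp only: ball_simps fun_diff_def tendsto_norm_zero_iff LIM_zero_iff)
  finally show ?thesis .
qed

text \<open>Weak* convergence is pointwise convergence on \<open>YF\<close>, and at a point
  \<open>x\<close> the partial sums in \<open>E2\<close> are the images under \<open>h\<close> of
  those in \<open>E1\<close>; continuity of \<open>h\<close> gives the limit.\<close>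

lemma E1_imp_E2:
  assumes g: "\<And>i. g i \<in> frechet_dual sc Y n" and f: "\<And>i. f i \<in> YF" and E1: "E1 sc Y n g f"
  shows "E2 sc Y n g f"
  unfolding E2_def series_in_def limitin_weak_star
proof (intro ballI conjI eventuallyI frechet_dual_combination g)
  fix h x assume h: "h \<in> frechet_dual sc Y n" and x: "x \<in> YF"
  interpret h: linear_map_on sc "(*)" YF h by (rule frechet_dual_linear[OF h])
  have "limitin euclidean (h \<circ> (\<lambda>N. \<Sum>i<N. sc (g i x) (f i))) (h x) sequentially"
  proof (rule continuous_map_limit)
    show "limitin (frechet_topology Y n) (\<lambda>N. \<Sum>i<N. sc (g i x) (f i)) x sequentially"
      using E1 x unfolding E1_def series_in_def by blast
    show "continuous_map (frechet_topology Y n) euclidean h"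
      using h by (simp add: frechet_dual_def)
  qed
  then show "(\<lambda>N. (\<Sum>i<N. fun_scale (h (f i)) (g i)) x) \<longlonglongrightarrow> h x"
    using h.sum_scale[of "{..<_}" f "\<lambda>i. g i x"] f
    by (simp add: comp_def sum_fun_apply fun_scale_def mult.commute)
qed

end

subsection \<open>Frames\<close>

context normed_subspace
begin

text \<open>The canonical embedding into the bidual, with \<open>n x\<close> as bound. The
  definitions of Bessel sequence and frame demand it of the vectors \<open>f i\<close>.\<close>

lemma evaluation_dual:
  assumes "x \<in> Y"
  shows "(\<lambda>h. h x) \<in> banach_dual fun_scale (banach_dual sc Y n) (dual_norm Y n)"
  using norm_le_dual_norm[OF _ assms]
  by (intro banach_dualI[where C = "n x"]) (auto simp: fun_scale_def mult.commute)

text \<open>Places the remainders of dual expansions in the dual, both for functionals on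
  \<open>X (t k)\<close> and for functionals on \<open>\<Theta> k\<close>, so that their dual norms
  are meaningful.\<close>

lemma banach_dual_combination:
  assumes h: "h \<in> banach_dual sc Y n" and u: "\<And>i. u i \<in> banach_dual sc Y n"
  shows "h - (\<Sum>i<(N::nat). fun_scale (c i) (u i)) \<in> banach_dual sc Y n"
proof -
  have eq: "h - (\<Sum>i<N. fun_scale (c i) (u i)) = (\<lambda>x. h x - (\<Sum>i<N. c i * u i x))"
    by (rule ext) (simp add: sum_fun_apply fun_scale_def)
  show ?thesis
    unfolding eq
  proof (rule banach_dualI)
    fix x y assume "x \<in> Y" "y \<in> Y"
    then show "h (x + y) - (\<Sum>i<N. c i * u i (x + y)) =
        h x - (\<Sum>i<N. c i * u i x) + (h y - (\<Sum>i<N. c i * u i y))"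
      by (simp add: banach_dualD(1)[OF h] banach_dualD(1)[OF u] distrib_left sum.distrib)
  next
    fix a x assume "x \<in> Y"
    then show "h (sc a x) - (\<Sum>i<N. c i * u i (sc a x)) = a * (h x - (\<Sum>i<N. c i * u i x))"
      by (simp add: banach_dualD(2)[OF h] banach_dualD(2)[OF u] right_diff_distrib
          sum_distrib_left mult.left_commute)
  next
    fix x assume x: "x \<in> Y"
    have "norm (h x - (\<Sum>i<N. c i * u i x)) \<le> norm (h x) + (\<Sum>i<N. norm (c i * u i x))"
      by (rule order_trans[OF norm_triangle_ineq4 add_left_mono[OF norm_sum]])
    also have "\<dots> \<le> dual_norm Y n h * n x + (\<Sum>i<N. norm (c i) * (dual_norm Y n (u i) * n x))"
      unfolding norm_mult
      by (intro add_mono sum_mono mult_left_mono norm_le_dual_norm h u x norm_ge_zero)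
    also have "\<dots> = (dual_norm Y n h + (\<Sum>i<N. norm (c i) * dual_norm Y n (u i))) * n x"
      by (simp add: distrib_right sum_distrib_right mult.assoc)
    finally show "norm (h x - (\<Sum>i<N. c i * u i x)) \<le>
        (dual_norm Y n h + (\<Sum>i<N. norm (c i) * dual_norm Y n (u i))) * n x" .
  qed
qed

end

section \<open>A pre-Frechet frame with CB coefficient spaces\<close>

locale frame_setting = vector_space sc
  for sc :: "'k::{real_normed_field,euclidean_space} \<Rightarrow> 'a::ab_group_add \<Rightarrow> 'a" +
  fixes X :: "nat \<Rightarrow> 'a set" and nX :: "nat \<Rightarrow> 'a \<Rightarrow> real"
    and \<Theta> :: "nat \<Rightarrow> (nat \<Rightarrow> 'k) set" and n\<Theta> :: "nat \<Rightarrow> (nat \<Rightarrow> 'k) \<Rightarrow> real"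
    and s t :: "nat \<Rightarrow> nat" and g :: "nat \<Rightarrow> 'a \<Rightarrow> 'k"
  assumes scale_X: "admissible_scale sc X nX"
    and scale_\<Theta>: "admissible_scale fun_scale \<Theta> n\<Theta>"
    and frame: "pre_frechet_frame sc X nX \<Theta> n\<Theta> s t g"
    and CB: "CB_space (\<Theta> k) (n\<Theta> k)"
begin

sublocale X: scale_space sc X nX
  by unfold_locales (rule scale_X)

sublocale T: scale_space fun_scale \<Theta> n\<Theta>
  by (intro scale_space.intro scale_space_axioms.intro vector_space_fun_scale scale_\<Theta>)

abbreviation "XF \<equiv> X.YF"
abbreviation "\<Theta>F \<equiv> T.YF"

lemma g_dual: "g i \<in> frechet_dual sc X nX"
  using frame unfolding pre_frechet_frame_def by (elim conjE) (rule spec)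

lemma s_at_top: "filterlim s at_top sequentially"
  using frame unfolding pre_frechet_frame_def by (elim conjE)

lemma s_le_t: "s k \<le> t k"
  using frame unfolding pre_frechet_frame_def by (elim conjE) (rule spec)

lemma frame_bounds:
  obtains A B where "\<forall>k. 0 < A k \<and> 0 < B k \<and> (\<forall>f\<in>X.YF. (\<lambda>i. g i f) \<in> T.YF \<and>
    A k * nX (s k) f \<le> n\<Theta> k (\<lambda>i. g i f) \<and> n\<Theta> k (\<lambda>i. g i f) \<le> B k * nX (t k) f)"
  using frame unfolding pre_frechet_frame_def by (elim conjE exE) (rule that)

sublocale g: linear_map_on sc "(*)" XF "g i" for i
  by (rule X.frechet_dual_linear[OF g_dual])

lemma coeff_mem: "x \<in> XF \<Longrightarrow> (\<lambda>i. g i x) \<in> \<Theta>F"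
  by (rule frame_bounds) (simp only:)

lemma coeff_bound:
  obtains B where "B > 0" "\<forall>x\<in>XF. n\<Theta> k (\<lambda>i. g i x) \<le> B * nX (t k) x"
proof (rule frame_bounds)
  fix A B
  assume "\<forall>k. 0 < A k \<and> 0 < B k \<and> (\<forall>f\<in>XF. (\<lambda>i. g i f) \<in> \<Theta>F \<and>
    A k * nX (s k) f \<le> n\<Theta> k (\<lambda>i. g i f) \<and> n\<Theta> k (\<lambda>i. g i f) \<le> B k * nX (t k) f)"
  from spec[OF this, of k] show thesis
    by (intro that[of "B k"]) simp_all
qed

lemma unit_seq_mem: "unit_seq i \<in> \<Theta>F"
  using CB_unit_seq[OF CB] by blast

lemma truncate_mem: "truncate N d \<in> \<Theta> k"
  by (rule CB_truncate_mem[OF CB])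

lemma truncate_memF: "truncate N d \<in> \<Theta>F"
  using truncate_mem by blast

lemma coordinate_dual: "(\<lambda>d. d i) \<in> banach_dual fun_scale (\<Theta> k) (n\<Theta> k)"
  using CB[of k] by (simp add: CB_space_def BK_space_def)

lemma X_s_t: "x \<in> X (t k) \<Longrightarrow> x \<in> X (s k)"
  using X.Y_antimono[OF s_le_t] by blast

section \<open>The extended coefficient functionals and the analysis map\<close>

abbreviation gext :: "nat \<Rightarrow> nat \<Rightarrow> 'a \<Rightarrow> 'k" where
  "gext k i \<equiv> cont_ext sc (X (t k)) (nX (t k)) XF (g i)"

text \<open>Continuity on \<open>XF\<close> alone does not say which norm controls
  \<open>g i\<close>. The norm of index \<open>t k\<close> does: the upper frame bound controls the
  whole coefficient sequence in \<open>\<Theta> k\<close>, and the coordinate functional then picks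
  out one entry. With this bound the extension by density exists, so the choice in
  \<open>cont_ext\<close> is a proper one.\<close>

lemma gext: "gext k i \<in> banach_dual sc (X (t k)) (nX (t k)) \<and> (\<forall>x\<in>XF. gext k i x = g i x)"
proof -
  obtain B where B: "B > 0" "\<forall>x\<in>XF. n\<Theta> k (\<lambda>i. g i x) \<le> B * nX (t k) x"
    by (rule coeff_bound)
  let ?D = "dual_norm (\<Theta> k) (n\<Theta> k) (\<lambda>d. d i)"
  have D: "?D \<ge> 0" by (rule T.S.dual_norm_nonneg[OF coordinate_dual])
  have bound: "norm (g i x) \<le> (?D * B) * nX (t k) x" if x: "x \<in> XF" for x
  proof -
    have "(\<lambda>i. g i x) \<in> \<Theta> k" using coeff_mem[OF x] by blast
    from T.S.norm_le_dual_norm[OF coordinate_dual this]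
    have "norm (g i x) \<le> ?D * n\<Theta> k (\<lambda>i. g i x)" .
    also have "\<dots> \<le> ?D * (B * nX (t k) x)"
      using B(2) x D by (intro mult_left_mono) blast+
    finally show ?thesis by (simp add: mult.assoc)
  qed
  have DB: "?D * B \<ge> 0" using D B(1) by simp
  obtain h' where "h' \<in> banach_dual sc (X (t k)) (nX (t k))" "\<forall>x\<in>XF. h' x = g i x"
    by (rule X.S.dense_extension[OF X.dense X.subspace_YF X.YF_subset g.add g.scale bound DB])
  then have "\<exists>h'. h' \<in> banach_dual sc (X (t k)) (nX (t k)) \<and> (\<forall>x\<in>XF. h' x = g i x)" by blast
  from someI_ex[OF this] show ?thesis unfolding cont_ext_def .
qed

lemmas gext_dual = gext[THEN conjunct1]

lemma gext_eq: "x \<in> XF \<Longrightarrow> gext k i x = g i x"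
  using gext by blast

text \<open>By linearity the analysis map is Lipschitz on \<open>XF\<close>, so it sends an
  approximating sequence to a Cauchy sequence in \<open>\<Theta> k\<close>; the coordinate
  functionals identify its limit as the extended coefficients. The constant \<open>B\<close> enters
  as a parameter so that one choice can serve several estimates.\<close>

lemma gext_mem_bound:
  assumes B: "B > 0" "\<forall>x\<in>XF. n\<Theta> k (\<lambda>i. g i x) \<le> B * nX (t k) x" and x: "x \<in> X (t k)"
  shows "(\<lambda>i. gext k i x) \<in> \<Theta> k" and "n\<Theta> k (\<lambda>i. gext k i x) \<le> B * nX (t k) x"
proof -
  obtain y where "\<forall>j. y j \<in> XF" "\<forall>j. y j \<in> X (t k)" and lim: "(\<lambda>j. nX (t k) (y j - x)) \<longlonglongrightarrow> 0"
    by (rule X.S.dense_sequence[OF X.dense x])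
  then have y: "y j \<in> XF" and yX: "y j \<in> X (t k)" for j by simp_all
  define u where "u = (\<lambda>j i. g i (y j))"
  have u: "u j \<in> \<Theta> k" for j
    unfolding u_def using coeff_mem[OF y[of j]] by blast
  have diff: "n\<Theta> k (u i - u j) \<le> B * nX (t k) (y i - y j)" for i j
  proof -
    have yy: "y i - y j \<in> XF" by (intro subspace_diff X.subspace_YF y)
    have "u i - u j = (\<lambda>l. g l (y i - y j))"
      by (rule ext) (simp add: u_def g.diff[OF y y])
    with B(2) yy show ?thesis by simp
  qed
  obtain d where d: "d \<in> \<Theta> k" and dlim: "(\<lambda>j. n\<Theta> k (u j - d)) \<longlonglongrightarrow> 0"
  proof (rule T.S.Cauchy_limit[OF T.complete u])
    fix e :: real assume "e > 0"
    then have "e / B > 0" using B(1) by simp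
    from X.S.convergent_imp_Cauchy[OF yX x lim this]
    obtain M where M: "\<forall>i\<ge>M. \<forall>j\<ge>M. nX (t k) (y i - y j) < e / B" by blast
    have "n\<Theta> k (u i - u j) < e" if "i \<ge> M" "j \<ge> M" for i j
    proof -
      have "nX (t k) (y i - y j) < e / B" using M that by blast
      then have "B * nX (t k) (y i - y j) < e" using B(1) by (simp add: pos_less_divide_eq mult.commute)
      with diff show ?thesis by (rule le_less_trans)
    qed
    then show "\<exists>N. \<forall>i\<ge>N. \<forall>j\<ge>N. n\<Theta> k (u i - u j) < e" by blast
  qed
  have eq: "d = (\<lambda>i. gext k i x)"
  proof
    fix i
    have "(\<lambda>j. u j i) \<longlonglongrightarrow> d i"
      by (rule T.S.dual_limit[OF coordinate_dual u d dlim])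
    moreover have "(\<lambda>j. u j i) \<longlonglongrightarrow> gext k i x"
      using X.S.dual_limit[OF gext_dual yX x lim, of i] unfolding gext_eq[OF y] u_def .
    ultimately show "d i = gext k i x" by (rule LIMSEQ_unique)
  qed
  show "(\<lambda>i. gext k i x) \<in> \<Theta> k" using d unfolding eq .
  have "n\<Theta> k d \<le> B * nX (t k) x"
  proof (rule LIMSEQ_le_const)
    \<comment> \<open>The bound is proved for each \<open>j\<close> with two error terms, one for
      replacing \<open>x\<close> by \<open>y j\<close> and one for replacing \<open>d\<close> by
      \<open>u j\<close>; both vanish in the limit, so \<open>B\<close> itself survives.\<close>
    have "(\<lambda>j. B * nX (t k) x + (B * nX (t k) (y j - x) + n\<Theta> k (u j - d)))
        \<longlonglongrightarrow> B * nX (t k) x + (B * 0 + 0)"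
      by (intro tendsto_add tendsto_mult tendsto_const lim dlim)
    then show "(\<lambda>j. B * nX (t k) x + (B * nX (t k) (y j - x) + n\<Theta> k (u j - d)))
        \<longlonglongrightarrow> B * nX (t k) x" by simp
    have "n\<Theta> k d \<le> B * nX (t k) x + (B * nX (t k) (y j - x) + n\<Theta> k (u j - d))" for j
    proof -
      have "n\<Theta> k (u j) \<le> B * nX (t k) (y j)" using B(2) y[of j] by (simp add: u_def)
      also have "nX (t k) (y j) \<le> nX (t k) x + nX (t k) (y j - x)"
        using X.S.triangle[OF x X.S.mem_diff[OF yX x], of j] by simp
      finally have "n\<Theta> k (u j) \<le> B * nX (t k) x + B * nX (t k) (y j - x)"
        using B(1) by (simp add: distrib_left)
      moreover have "n\<Theta> k d \<le> n\<Theta> k (u j) + n\<Theta> k (u j - d)"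
        using T.S.triangle_diff[OF u T.S.mem_diff[OF u d], of j j] by simp
      ultimately show ?thesis by simp
    qed
    then show "\<exists>N. \<forall>j\<ge>N. n\<Theta> k d \<le> B * nX (t k) x + (B * nX (t k) (y j - x) + n\<Theta> k (u j - d))"
      by blast
  qed
  then show "n\<Theta> k (\<lambda>i. gext k i x) \<le> B * nX (t k) x" unfolding eq .
qed

lemma gext_mem: "x \<in> X (t k) \<Longrightarrow> (\<lambda>i. gext k i x) \<in> \<Theta> k"
  by (rule coeff_bound[of k]) (rule gext_mem_bound(1))

lemma E1_iff:
  assumes "\<And>i. f i \<in> XF"
  shows "E1 sc X nX g f \<longleftrightarrow>
    (\<forall>x\<in>XF. \<forall>r. (\<lambda>N. nX r ((\<Sum>i<N. sc (g i x) (f i)) - x)) \<longlonglongrightarrow> 0)"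
proof -
  have "(\<Sum>i<N. sc (g i x) (f i)) \<in> XF" for N x
    by (intro subspace_sum subspace_scale X.subspace_YF assms)
  then show ?thesis
    unfolding E1_def series_in_def X.limitin_frechet by simp
qed

lemma E3_iff:
  assumes "\<And>i. f i \<in> XF"
  shows "E3 sc X nX (s k) (t k) g f \<longleftrightarrow>
    (\<forall>x\<in>X (t k). (\<lambda>N. nX (s k) ((\<Sum>i<N. sc (gext k i x) (f i)) - x)) \<longlonglongrightarrow> 0)"
proof -
  have "f i \<in> X (s k)" for i using assms by blast
  then have "(\<Sum>i<N. sc (gext k i x) (f i)) \<in> X (s k)" for N x
    by (intro X.S.mem_sum X.S.mem_scale)
  then show ?thesis
    unfolding E3_def series_in_def X.S.limitin_norm using X_s_t by simp
qed

lemma operator_linear: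
  assumes "operator_on fun_scale sc \<Theta>F XF V"
  shows "linear_map_on fun_scale sc \<Theta>F V"
proof (intro linear_map_on.intro linear_map_on_axioms.intro vector_space_axioms
    vector_space_fun_scale T.subspace_YF)
  show "V (x + y) = V x + V y" if "x \<in> \<Theta>F" "y \<in> \<Theta>F" for x y
    using assms that unfolding operator_on_def by blast
  show "V (fun_scale c x) = sc c (V x)" if "x \<in> \<Theta>F" for c x
    using assms that unfolding operator_on_def by blast
qed

lemma operator_truncate:
  assumes "operator_on fun_scale sc \<Theta>F XF V"
  shows "V (truncate N d) = (\<Sum>i<N. sc (d i) (V (unit_seq i)))"
  unfolding sum_unit_seq[symmetric]
  by (rule linear_map_on.sum_scale[OF operator_linear[OF assms]]) (rule unit_seq_mem)

text \<open>The part common to a continuous \<open>V\<close> and to one with the bounds of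
  \<open>A1_operator\<close>: the two differ only in how convergence of
  \<open>V (truncate N d)\<close> is obtained.\<close>

lemma operator_E1:
  assumes V: "operator_on fun_scale sc \<Theta>F XF V"
    and left_inverse: "\<forall>x\<in>XF. V (\<lambda>i. g i x) = x"
    and lim: "\<And>d r. d \<in> \<Theta>F \<Longrightarrow> (\<lambda>N. nX r (V (truncate N d) - V d)) \<longlonglongrightarrow> 0"
  shows "E1 sc X nX g (\<lambda>i. V (unit_seq i))"
proof -
  have mem: "V (unit_seq i) \<in> XF" for i
    using V unit_seq_mem unfolding operator_on_def by blast
  show ?thesis
    unfolding E1_iff[OF mem]
  proof (intro ballI allI)
    fix x r assume x: "x \<in> XF"
    show "(\<lambda>N. nX r ((\<Sum>i<N. sc (g i x) (V (unit_seq i))) - x)) \<longlonglongrightarrow> 0"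
      using lim[OF coeff_mem[OF x], of r] left_inverse x unfolding operator_truncate[OF V] by simp
  qed
qed

lemma truncate_limit: "d \<in> \<Theta> k \<Longrightarrow> (\<lambda>N. n\<Theta> k (truncate N d - d)) \<longlonglongrightarrow> 0"
  by (rule CB_expansion[OF CB])

lemma continuous_operator_E1:
  assumes V: "operator_on fun_scale sc \<Theta>F XF V"
    and cont: "continuous_map (frechet_topology \<Theta> n\<Theta>) (frechet_topology X nX) V"
    and left_inverse: "\<forall>x\<in>XF. V (\<lambda>i. g i x) = x"
  shows "E1 sc X nX g (\<lambda>i. V (unit_seq i))"
proof (rule operator_E1[OF V left_inverse])
  fix d r assume d: "d \<in> \<Theta>F"
  have "limitin (frechet_topology \<Theta> n\<Theta>) (\<lambda>N. truncate N d) d sequentially"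
    unfolding T.limitin_frechet
  proof (intro conjI allI eventuallyI d truncate_memF)
    show "(\<lambda>N. n\<Theta> r (truncate N d - d)) \<longlonglongrightarrow> 0" for r
      using d by (intro truncate_limit) blast
  qed
  from continuous_map_limit[OF cont this]
  show "(\<lambda>N. nX r (V (truncate N d) - V d)) \<longlonglongrightarrow> 0"
    unfolding X.limitin_frechet comp_def by blast
qed

end

subsection \<open>From the operator to the expansions\<close>

context frame_setting
begin

lemma dual_s_t:
  assumes h: "h \<in> banach_dual sc (X (s k)) (nX (s k))"
  shows "h \<in> banach_dual sc (X (t k)) (nX (t k))"
proof (rule banach_dualI)
  show "h (x + y) = h x + h y" if "x \<in> X (t k)" "y \<in> X (t k)" for x y
    by (rule banach_dualD(1)[OF h X_s_t X_s_t]) (rule that)+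
  show "h (sc a x) = a * h x" if "x \<in> X (t k)" for a x
    by (rule banach_dualD(2)[OF h X_s_t[OF that]])
  show "norm (h x) \<le> dual_norm (X (s k)) (nX (s k)) h * nX (t k) x" if x: "x \<in> X (t k)" for x
    by (rule order_trans[OF X.S.norm_le_dual_norm[OF h X_s_t[OF x]]
        mult_left_mono[OF X.n_mono[OF s_le_t x] X.S.dual_norm_nonneg[OF h]]])
qed

context
  fixes V
  assumes A1: "A1_operator sc X nX \<Theta> n\<Theta> s g V"
begin

lemma V: "operator_on fun_scale sc \<Theta>F XF V"
  using A1 unfolding A1_operator_def by (elim conjE)

lemma left_inverse: "\<forall>x\<in>XF. V (\<lambda>i. g i x) = x"
  using A1 unfolding A1_operator_def by (elim conjE)

lemma V_bound:
  obtains C where "C > 0" "\<forall>d\<in>\<Theta>F. nX (s k) (V d) \<le> C * n\<Theta> k d"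
  using A1 unfolding A1_operator_def by (elim conjE allE[of _ k] exE) (rule that)

interpretation V: linear_map_on fun_scale sc \<Theta>F V
  by (rule operator_linear[OF V])

lemma V_mem: "d \<in> \<Theta>F \<Longrightarrow> V d \<in> XF"
  using V unfolding operator_on_def by blast

lemma V_unit_mem: "V (unit_seq i) \<in> XF"
  by (rule V_mem[OF unit_seq_mem])

lemma V_diff_bound:
  assumes C: "\<forall>d\<in>\<Theta>F. nX (s k) (V d) \<le> C * n\<Theta> k d" and d: "d \<in> \<Theta>F" "d' \<in> \<Theta>F"
  shows "nX (s k) (V d - V d') \<le> C * n\<Theta> k (d - d')"
proof -
  have "d - d' \<in> \<Theta>F" by (rule T.subspace_diff[OF T.subspace_YF d])
  with C show ?thesis unfolding V.diff[OF d, symmetric] by blast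
qed

text \<open>The bound from norm \<open>k\<close> to norm \<open>s k\<close>, applied to
  \<open>truncate N d - d\<close>, gives convergence in every norm of index \<open>s k\<close>;
  cofinality covers the others.\<close>

lemma A1_E1: "E1 sc X nX g (\<lambda>i. V (unit_seq i))"
proof (rule operator_E1[OF V left_inverse])
  fix d r assume d: "d \<in> \<Theta>F"
  show "(\<lambda>N. nX r (V (truncate N d) - V d)) \<longlonglongrightarrow> 0"
  proof (rule X.limit_cofinal[OF s_at_top V_mem[OF truncate_memF] V_mem[OF d]])
    fix k
    obtain C where C: "C > 0" "\<forall>d\<in>\<Theta>F. nX (s k) (V d) \<le> C * n\<Theta> k d" by (rule V_bound)
    have dk: "d \<in> \<Theta> k" using d by blast
    have mem: "V (truncate N d) - V d \<in> X (s k)" for N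
      using V_mem[OF truncate_memF] V_mem[OF d] by (intro X.S.mem_diff) blast+
    show "(\<lambda>N. nX (s k) (V (truncate N d) - V d)) \<longlonglongrightarrow> 0"
    proof (rule tendsto_sandwich[OF _ _ tendsto_const])
      show "(\<lambda>N. C * n\<Theta> k (truncate N d - d)) \<longlonglongrightarrow> 0"
        by (rule tendsto_mult_right_zero[OF truncate_limit[OF dk]])
    qed (intro eventuallyI X.S.nonneg mem, intro eventuallyI V_diff_bound C(2) truncate_memF d)
  qed
qed

lemma A1_E2: "E2 sc X nX g (\<lambda>i. V (unit_seq i))"
  by (rule X.E1_imp_E2[OF g_dual V_unit_mem A1_E1])

text \<open>An element \<open>x\<close> of the completion is compared with a nearby \<open>y\<close> in the Frechet space, for
  which \<open>y = V (g y)\<close>; in this way \<open>V\<close> need not be extended to all of \<open>\<Theta> k\<close>.\<close>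

lemma A1_E3: "E3 sc X nX (s k) (t k) g (\<lambda>i. V (unit_seq i))"
  unfolding E3_iff[OF V_unit_mem]
proof
  fix x assume x: "x \<in> X (t k)"
  define d where "d = (\<lambda>i. gext k i x)"
  have d: "d \<in> \<Theta> k" unfolding d_def by (rule gext_mem[OF x])
  obtain C where C: "C > 0" "\<forall>d\<in>\<Theta>F. nX (s k) (V d) \<le> C * n\<Theta> k d" by (rule V_bound)
  obtain B where B: "B > 0" "\<forall>x\<in>XF. n\<Theta> k (\<lambda>i. g i x) \<le> B * nX (t k) x" by (rule coeff_bound)
  have sum: "(\<Sum>i<N. sc (gext k i x) (V (unit_seq i))) = V (truncate N d)" for N
    unfolding operator_truncate[OF V] d_def ..
  have Vt: "V (truncate N d) \<in> X (s k)" for N using V_mem[OF truncate_memF] by blast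
  have xs: "x \<in> X (s k)" by (rule X_s_t[OF x])
  \<comment> \<open>The bound of \<open>V\<close> at \<open>truncate N d - d\<close>, with
    \<open>x\<close> standing in for the value of \<open>V\<close> at \<open>d\<close>, which need
    not lie in \<open>\<Theta>F\<close>.\<close>
  have le: "nX (s k) (V (truncate N d) - x) \<le> C * n\<Theta> k (truncate N d - d)" for N
  proof -
    \<comment> \<open>In \<open>C * B + 1\<close>, the product accounts for replacing
      \<open>d\<close> by the coefficients of \<open>y\<close> under \<open>V\<close>, and the 1 for
      replacing \<open>x\<close> by \<open>y\<close> in the norm of index
      \<open>s k\<close>.\<close>
    have "nX (s k) (V (truncate N d) - x) - C * n\<Theta> k (truncate N d - d) \<le> (C * B + 1) * e"
      if e: "e > 0" for e
    proof -
      obtain y where y: "y \<in> XF" "y \<in> X (t k)" "nX (t k) (y - x) < e"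
        by (rule X.S.dense_approx[OF X.dense x e])
      have ys: "y \<in> X (s k)" by (rule X_s_t[OF y(2)])
      define u where "u = (\<lambda>i. g i y)"
      have u: "u \<in> \<Theta>F" unfolding u_def by (rule coeff_mem[OF y(1)])
      then have uk: "u \<in> \<Theta> k" by blast
      have Vu: "V u = y" using left_inverse y(1) unfolding u_def by blast
      have xy: "y - x \<in> X (t k)" "x - y \<in> X (t k)"
        by (intro X.S.mem_diff x y)+
      have du: "d - u = (\<lambda>i. gext k i (x - y))"
      proof
        fix i
        have "gext k i (x - y) = gext k i x - gext k i y"
          by (rule linear_map_on.diff[OF X.S.dual_linear[OF gext_dual] x y(2)])
        then show "(d - u) i = gext k i (x - y)"
          using gext_eq[OF y(1), of k i] by (simp add: d_def u_def)
      qed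
      have "n\<Theta> k (d - u) \<le> B * nX (t k) (y - x)"
        using gext_mem_bound(2)[OF B xy(2)] X.S.norm_diff_commute[OF x y(2)] unfolding du by simp
      then have "n\<Theta> k (truncate N d - u) \<le> n\<Theta> k (truncate N d - d) + B * nX (t k) (y - x)"
        using T.S.triangle_via[OF truncate_mem d uk, of N d] by linarith
      then have "C * n\<Theta> k (truncate N d - u) \<le> C * (n\<Theta> k (truncate N d - d) + B * nX (t k) (y - x))"
        using C(1) by (rule mult_left_mono[OF _ less_imp_le])
      moreover have "nX (s k) (V (truncate N d) - y) \<le> C * n\<Theta> k (truncate N d - u)"
        using V_diff_bound[OF C(2) truncate_memF u] unfolding Vu .
      moreover have "nX (s k) (V (truncate N d) - x) \<le> nX (s k) (V (truncate N d) - y) + nX (s k) (y - x)"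
        by (rule X.S.triangle_via[OF Vt ys xs])
      moreover have "nX (s k) (y - x) \<le> nX (t k) (y - x)"
        by (rule X.n_mono[OF s_le_t xy(1)])
      ultimately have "nX (s k) (V (truncate N d) - x)
          \<le> C * (n\<Theta> k (truncate N d - d) + B * nX (t k) (y - x)) + nX (t k) (y - x)"
        by linarith
      moreover have "C * (n\<Theta> k (truncate N d - d) + B * nX (t k) (y - x)) + nX (t k) (y - x)
          = C * n\<Theta> k (truncate N d - d) + (C * B + 1) * nX (t k) (y - x)"
        by (simp only: algebra_simps)
      moreover have "(C * B + 1) * nX (t k) (y - x) \<le> (C * B + 1) * e"
        using y(3) B(1) C(1) by (intro mult_left_mono) simp_all
      ultimately show ?thesis by linarith
    qed
    then have "nX (s k) (V (truncate N d) - x) - C * n\<Theta> k (truncate N d - d) \<le> 0"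
      using B(1) C(1) by (intro le_zero_if_le_mult_epsilon[of "C * B + 1"]) simp_all
    then show ?thesis by simp
  qed
  show "(\<lambda>N. nX (s k) ((\<Sum>i<N. sc (gext k i x) (V (unit_seq i))) - x)) \<longlonglongrightarrow> 0"
    unfolding sum
  proof (rule tendsto_sandwich[OF _ _ tendsto_const])
    show "(\<lambda>N. C * n\<Theta> k (truncate N d - d)) \<longlonglongrightarrow> 0"
      by (rule tendsto_mult_right_zero[OF truncate_limit[OF d]])
  qed (intro eventuallyI X.S.nonneg X.S.mem_diff Vt xs, intro eventuallyI le)
qed

text \<open>The functional \<open>\<phi>\<close> is the value at \<open>h\<close> of the adjoint of
  \<open>V\<close>. The constant \<open>C\<close> is fixed beforehand so that the bound is uniform
  in \<open>h\<close>, as the Bessel inequality requires.\<close>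

lemma transposed_functional:
  assumes C: "C > 0" "\<forall>d\<in>\<Theta>F. nX (s k) (V d) \<le> C * n\<Theta> k d"
    and h: "h \<in> banach_dual sc (X (s k)) (nX (s k))"
  obtains \<phi> where "\<phi> \<in> banach_dual fun_scale (\<Theta> k) (n\<Theta> k)"
    "\<forall>i. \<phi> (unit_seq i) = h (V (unit_seq i))"
    "dual_norm (\<Theta> k) (n\<Theta> k) \<phi> \<le> C * dual_norm (X (s k)) (nX (s k)) h"
proof -
  let ?H = "dual_norm (X (s k)) (nX (s k)) h"
  have H: "?H \<ge> 0" by (rule X.S.dual_norm_nonneg[OF h])
  have VX: "V d \<in> X (s k)" if "d \<in> \<Theta>F" for d using V_mem[OF that] by blast
  have add: "h (V (x + y)) = h (V x) + h (V y)" if "x \<in> \<Theta>F" "y \<in> \<Theta>F" for x y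
    unfolding V.add[OF that] by (rule banach_dualD(1)[OF h VX VX]) (rule that)+
  have scale: "h (V (fun_scale c x)) = c * h (V x)" if "x \<in> \<Theta>F" for c x
    unfolding V.scale[OF that] by (rule banach_dualD(2)[OF h VX[OF that]])
  have bound: "norm (h (V d)) \<le> (C * ?H) * n\<Theta> k d" if d: "d \<in> \<Theta>F" for d
  proof -
    have "norm (h (V d)) \<le> ?H * nX (s k) (V d)" by (rule X.S.norm_le_dual_norm[OF h VX[OF d]])
    also have "\<dots> \<le> ?H * (C * n\<Theta> k d)" using C(2) d H by (intro mult_left_mono) blast+
    finally show ?thesis by (simp add: mult.assoc mult.left_commute)
  qed
  have CH: "C * ?H \<ge> 0" using C(1) H by simp
  obtain \<phi> where \<phi>: "\<phi> \<in> banach_dual fun_scale (\<Theta> k) (n\<Theta> k)" "\<forall>d\<in>\<Theta>F. \<phi> d = h (V d)"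
    "\<forall>d\<in>\<Theta> k. norm (\<phi> d) \<le> (C * ?H) * n\<Theta> k d"
    by (rule T.S.dense_extension[OF T.dense T.subspace_YF T.YF_subset add scale bound CH])
  show thesis
  proof (rule that[OF \<phi>(1)])
    show "\<forall>i. \<phi> (unit_seq i) = h (V (unit_seq i))" using \<phi>(2) unit_seq_mem by blast
    show "dual_norm (\<Theta> k) (n\<Theta> k) \<phi> \<le> C * ?H"
      by (rule T.S.dual_norm_le[OF _ CH]) (rule \<phi>(3)[rule_format])
  qed
qed

lemma A1_analysis:
  obtains C where "C > 0" "\<forall>h\<in>banach_dual sc (X (s k)) (nX (s k)).
    (\<lambda>i. h (V (unit_seq i))) \<in> seq_dual (\<Theta> k) (n\<Theta> k) \<and>
    seq_dual_norm (\<Theta> k) (n\<Theta> k) (\<lambda>i. h (V (unit_seq i))) \<le> C * dual_norm (X (s k)) (nX (s k)) h"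
proof -
  obtain C where C: "C > 0" "\<forall>d\<in>\<Theta>F. nX (s k) (V d) \<le> C * n\<Theta> k d" by (rule V_bound)
  show thesis
  proof (rule that[OF C(1)], intro ballI)
    fix h assume h: "h \<in> banach_dual sc (X (s k)) (nX (s k))"
    obtain \<phi> where \<phi>: "\<phi> \<in> banach_dual fun_scale (\<Theta> k) (n\<Theta> k)"
      "\<forall>i. \<phi> (unit_seq i) = h (V (unit_seq i))"
      "dual_norm (\<Theta> k) (n\<Theta> k) \<phi> \<le> C * dual_norm (X (s k)) (nX (s k)) h"
      by (rule transposed_functional[OF C h])
    have eq: "(\<lambda>i. h (V (unit_seq i))) = (\<lambda>i. \<phi> (unit_seq i))" using \<phi>(2) by simp
    show "(\<lambda>i. h (V (unit_seq i))) \<in> seq_dual (\<Theta> k) (n\<Theta> k) \<and>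
      seq_dual_norm (\<Theta> k) (n\<Theta> k) (\<lambda>i. h (V (unit_seq i))) \<le> C * dual_norm (X (s k)) (nX (s k)) h"
      unfolding eq seq_dual_norm_eq[OF CB \<phi>(1)] using \<phi>(1,3) by (auto simp: seq_dual_def)
  qed
qed

lemma V_unit_evaluation:
  "(\<lambda>h. h (V (unit_seq i))) \<in>
    banach_dual fun_scale (banach_dual sc (X (s k)) (nX (s k))) (dual_norm (X (s k)) (nX (s k)))"
  using V_unit_mem by (intro X.S.evaluation_dual) blast

lemma A1_bessel: "dual_bessel sc X nX (\<Theta> k) (n\<Theta> k) (s k) (\<lambda>i. V (unit_seq i))"
  unfolding dual_bessel_def bessel_sequence_def
proof (intro conjI allI V_unit_evaluation)
  show "\<exists>C. \<forall>h\<in>banach_dual sc (X (s k)) (nX (s k)).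
    (\<lambda>i. h (V (unit_seq i))) \<in> seq_dual (\<Theta> k) (n\<Theta> k) \<and>
    seq_dual_norm (\<Theta> k) (n\<Theta> k) (\<lambda>i. h (V (unit_seq i))) \<le> C * dual_norm (X (s k)) (nX (s k)) h"
    by (rule A1_analysis[of k]) (rule exI)
qed

text \<open>Both sides are limits of the same scalar sums: apply \<open>h\<close> to the expansion
  \<open>E3\<close> of \<open>x\<close>, and \<open>\<phi>\<close> to the basis expansion of the
  coefficients of \<open>x\<close>.\<close>

lemma A1_represent:
  assumes h: "h \<in> banach_dual sc (X (s k)) (nX (s k))"
    and \<phi>: "\<phi> \<in> banach_dual fun_scale (\<Theta> k) (n\<Theta> k)" "\<forall>i. \<phi> (unit_seq i) = h (V (unit_seq i))"
    and x: "x \<in> X (t k)"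
  shows "h x = \<phi> (\<lambda>i. gext k i x)"
proof -
  interpret h: linear_map_on sc "(*)" "X (s k)" h by (rule X.S.dual_linear[OF h])
  have mem: "V (unit_seq i) \<in> X (s k)" for i using V_unit_mem by blast
  have sum: "(\<Sum>i<N. sc (gext k i x) (V (unit_seq i))) \<in> X (s k)" for N
    by (intro X.S.mem_sum X.S.mem_scale mem)
  have lim: "(\<lambda>N. nX (s k) ((\<Sum>i<N. sc (gext k i x) (V (unit_seq i))) - x)) \<longlonglongrightarrow> 0"
    using A1_E3[of k] x unfolding E3_iff[OF V_unit_mem] by blast
  have "(\<lambda>N. \<Sum>i<N. gext k i x * h (V (unit_seq i))) \<longlonglongrightarrow> h x"
    using X.S.dual_limit[OF h sum X_s_t[OF x] lim] unfolding h.sum_scale[OF mem] .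
  moreover have "(\<lambda>N. \<Sum>i<N. gext k i x * h (V (unit_seq i))) \<longlonglongrightarrow> \<phi> (\<lambda>i. gext k i x)"
    using CB_dual_expansion[OF CB \<phi>(1) gext_mem[OF x]] unfolding \<phi>(2)[rule_format] .
  ultimately show ?thesis by (rule LIMSEQ_unique)
qed

text \<open>For the lower bound, \<open>h\<close> on \<open>X (t k)\<close> is \<open>\<phi>\<close>
  after the extended analysis map, whose norm is at most \<open>B\<close>; hence the dual norm of
  \<open>h\<close> there is at most \<open>B\<close> times that of \<open>\<phi>\<close>.\<close>

lemma A1_frame: "dual_frame sc X nX (\<Theta> k) (n\<Theta> k) (s k) (t k) (\<lambda>i. V (unit_seq i))"
  unfolding dual_frame_def banach_frame_def
proof (intro conjI allI V_unit_evaluation)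
  obtain C where C: "C > 0" "\<forall>d\<in>\<Theta>F. nX (s k) (V d) \<le> C * n\<Theta> k d" by (rule V_bound)
  obtain B where B: "B > 0" "\<forall>x\<in>XF. n\<Theta> k (\<lambda>i. g i x) \<le> B * nX (t k) x" by (rule coeff_bound)
  \<comment> \<open>The estimate yields \<open>1 / B\<close>; the minimum with \<open>C\<close>
    ensures that the lower constant does not exceed the upper one.\<close>
  define A where "A = min (1 / B) C"
  have A: "A > 0" "A \<le> C" "A \<le> 1 / B" using B(1) C(1) by (simp_all add: A_def)
  have "(\<lambda>i. h (V (unit_seq i))) \<in> seq_dual (\<Theta> k) (n\<Theta> k) \<and>
      A * dual_norm (X (t k)) (nX (t k)) h \<le> seq_dual_norm (\<Theta> k) (n\<Theta> k) (\<lambda>i. h (V (unit_seq i))) \<and>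
      seq_dual_norm (\<Theta> k) (n\<Theta> k) (\<lambda>i. h (V (unit_seq i))) \<le> C * dual_norm (X (s k)) (nX (s k)) h"
    if h: "h \<in> banach_dual sc (X (s k)) (nX (s k))" for h
  proof -
    obtain \<phi> where \<phi>: "\<phi> \<in> banach_dual fun_scale (\<Theta> k) (n\<Theta> k)"
      "\<forall>i. \<phi> (unit_seq i) = h (V (unit_seq i))"
      "dual_norm (\<Theta> k) (n\<Theta> k) \<phi> \<le> C * dual_norm (X (s k)) (nX (s k)) h"
      by (rule transposed_functional[OF C h])
    let ?P = "dual_norm (\<Theta> k) (n\<Theta> k) \<phi>"
    have P: "?P \<ge> 0" by (rule T.S.dual_norm_nonneg[OF \<phi>(1)])
    have eq: "(\<lambda>i. h (V (unit_seq i))) = (\<lambda>i. \<phi> (unit_seq i))" using \<phi>(2) by simp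
    have "dual_norm (X (t k)) (nX (t k)) h \<le> B * ?P"
    proof (rule X.S.dual_norm_le)
      fix x assume x: "x \<in> X (t k)"
      have "norm (h x) \<le> ?P * n\<Theta> k (\<lambda>i. gext k i x)"
        unfolding A1_represent[OF h \<phi>(1,2) x] by (rule T.S.norm_le_dual_norm[OF \<phi>(1) gext_mem[OF x]])
      also have "\<dots> \<le> ?P * (B * nX (t k) x)"
        by (rule mult_left_mono[OF gext_mem_bound(2)[OF B x] P])
      finally show "norm (h x) \<le> B * ?P * nX (t k) x" by (simp add: mult.assoc mult.left_commute)
    qed (use B(1) P in simp)
    then have "A * dual_norm (X (t k)) (nX (t k)) h \<le> A * (B * ?P)"
      using A(1) by (intro mult_left_mono) simp_all
    also have "\<dots> \<le> 1 / B * (B * ?P)"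
      using A(3) B(1) P by (intro mult_right_mono) simp_all
    also have "\<dots> = ?P" using B(1) by simp
    finally show ?thesis
      unfolding eq seq_dual_norm_eq[OF CB \<phi>(1)] using \<phi>(1,3) by (auto simp: seq_dual_def)
  qed
  with A show "\<exists>A B. 0 < A \<and> A \<le> B \<and> (\<forall>h\<in>banach_dual sc (X (s k)) (nX (s k)).
      (\<lambda>i. h (V (unit_seq i))) \<in> seq_dual (\<Theta> k) (n\<Theta> k) \<and>
      A * dual_norm (X (t k)) (nX (t k)) h \<le> seq_dual_norm (\<Theta> k) (n\<Theta> k) (\<lambda>i. h (V (unit_seq i))) \<and>
      seq_dual_norm (\<Theta> k) (n\<Theta> k) (\<lambda>i. h (V (unit_seq i))) \<le> B * dual_norm (X (s k)) (nX (s k)) h)"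
    by (intro exI[of _ A] exI[of _ C]) simp
qed

text \<open>The remainder of the expansion of \<open>h\<close> is the remainder
  \<open>\<psi> N\<close> of the expansion of \<open>\<phi>\<close>, composed with the extended
  analysis map. Its norm is therefore at most \<open>B\<close> times that of
  \<open>\<psi> N\<close>, and the basis property of the dual sends the latter to 0.\<close>

lemma A1_E4:
  assumes CB_dual: "CB_space (seq_dual (\<Theta> k) (n\<Theta> k)) (seq_dual_norm (\<Theta> k) (n\<Theta> k))"
  shows "E4 sc X nX (s k) (t k) g (\<lambda>i. V (unit_seq i))"
  unfolding E4_def
proof
  fix h assume h: "h \<in> banach_dual sc (X (s k)) (nX (s k))"
  obtain C where C: "C > 0" "\<forall>d\<in>\<Theta>F. nX (s k) (V d) \<le> C * n\<Theta> k d" by (rule V_bound)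
  obtain B where B: "B > 0" "\<forall>x\<in>XF. n\<Theta> k (\<lambda>i. g i x) \<le> B * nX (t k) x" by (rule coeff_bound)
  obtain \<phi> where \<phi>: "\<phi> \<in> banach_dual fun_scale (\<Theta> k) (n\<Theta> k)"
    "\<forall>i. \<phi> (unit_seq i) = h (V (unit_seq i))"
    by (rule transposed_functional[OF C h])
  define c where "c = (\<lambda>i. h (V (unit_seq i)))"
  have c\<phi>: "c = (\<lambda>i. \<phi> (unit_seq i))" using \<phi>(2) by (simp add: c_def)
  have c: "c \<in> seq_dual (\<Theta> k) (n\<Theta> k)" unfolding c\<phi> seq_dual_def using \<phi>(1) by blast
  \<comment> \<open>The coordinate functionals are what the unit vectors of the sequence dual become
    as functionals on \<open>\<Theta> k\<close>, so the subtracted sum corresponds to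
    \<open>truncate N c\<close>.\<close>
  define \<psi> where "\<psi> = (\<lambda>N. \<phi> - (\<Sum>i<N. fun_scale (c i) (\<lambda>d. d i)))"
  have \<psi>: "\<psi> N \<in> banach_dual fun_scale (\<Theta> k) (n\<Theta> k)" for N
    unfolding \<psi>_def by (rule T.S.banach_dual_combination[OF \<phi>(1) coordinate_dual])
  have \<psi>_unit: "c - truncate N c = (\<lambda>j. \<psi> N (unit_seq j))" for N
  proof
    fix j
    have "(\<Sum>i<N. c i * unit_seq j i) = (\<Sum>i<N. if i = j then c i else 0)"
      by (rule sum.cong) (auto simp: unit_seq_def)
    then show "(c - truncate N c) j = \<psi> N (unit_seq j)"
      by (simp add: \<psi>_def sum_fun_apply fun_scale_def truncate_def c\<phi>)
  qed
  interpret D: normed_subspace fun_scale "seq_dual (\<Theta> k) (n\<Theta> k)" "seq_dual_norm (\<Theta> k) (n\<Theta> k)"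
    by (rule CB_normed_subspace[OF CB_dual])
  have norm_\<psi>: "dual_norm (\<Theta> k) (n\<Theta> k) (\<psi> N) = seq_dual_norm (\<Theta> k) (n\<Theta> k) (truncate N c - c)" for N
    unfolding seq_dual_norm_eq[OF CB \<psi>, symmetric] \<psi>_unit[symmetric]
    by (rule D.norm_diff_commute[OF c CB_truncate_mem[OF CB_dual]])
  have lim: "(\<lambda>N. dual_norm (\<Theta> k) (n\<Theta> k) (\<psi> N)) \<longlonglongrightarrow> 0"
    unfolding norm_\<psi> by (rule CB_expansion[OF CB_dual c])
  let ?R = "\<lambda>N. h - (\<Sum>i<N. fun_scale (h (V (unit_seq i))) (gext k i))"
  have le: "dual_norm (X (t k)) (nX (t k)) (?R N) \<le> B * dual_norm (\<Theta> k) (n\<Theta> k) (\<psi> N)" for N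
  proof (rule X.S.dual_norm_le)
    have P: "dual_norm (\<Theta> k) (n\<Theta> k) (\<psi> N) \<ge> 0" by (rule T.S.dual_norm_nonneg[OF \<psi>])
    then show "0 \<le> B * dual_norm (\<Theta> k) (n\<Theta> k) (\<psi> N)" using B(1) by simp
    fix x assume x: "x \<in> X (t k)"
    have "?R N x = \<psi> N (\<lambda>i. gext k i x)"
      unfolding \<psi>_def c_def using A1_represent[OF h \<phi> x] by (simp add: sum_fun_apply fun_scale_def)
    then have "norm (?R N x) \<le> dual_norm (\<Theta> k) (n\<Theta> k) (\<psi> N) * n\<Theta> k (\<lambda>i. gext k i x)"
      using T.S.norm_le_dual_norm[OF \<psi> gext_mem[OF x], of N] by simp
    also have "\<dots> \<le> dual_norm (\<Theta> k) (n\<Theta> k) (\<psi> N) * (B * nX (t k) x)"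
      by (rule mult_left_mono[OF gext_mem_bound(2)[OF B x] P])
    finally show "norm (?R N x) \<le> B * dual_norm (\<Theta> k) (n\<Theta> k) (\<psi> N) * nX (t k) x"
      by (simp add: mult.assoc mult.left_commute)
  qed
  show "(\<lambda>N. dual_norm (X (t k)) (nX (t k)) (?R N)) \<longlonglongrightarrow> 0"
  proof (rule tendsto_sandwich[OF _ _ tendsto_const tendsto_mult_right_zero[OF lim]])
    show "\<forall>\<^sub>F N in sequentially. 0 \<le> dual_norm (X (t k)) (nX (t k)) (?R N)"
      by (intro eventuallyI X.S.dual_norm_nonneg X.S.banach_dual_combination dual_s_t h gext_dual)
    show "\<forall>\<^sub>F N in sequentially. dual_norm (X (t k)) (nX (t k)) (?R N)
        \<le> B * dual_norm (\<Theta> k) (n\<Theta> k) (\<psi> N)"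
      by (intro eventuallyI le)
  qed
qed

end

end

subsection \<open>From the expansions to the operator\<close>

context frame_setting
begin

lemma bessel_bound:
  assumes f: "\<And>i. f i \<in> XF" and bessel: "dual_bessel sc X nX (\<Theta> k) (n\<Theta> k) (s k) f"
  obtains B where "B > 0"
    "\<forall>N c. nX (s k) (\<Sum>i<N. sc (c i) (f i)) \<le> B * n\<Theta> k (truncate N c)"
proof -
  obtain B0 where B0: "\<forall>h\<in>banach_dual sc (X (s k)) (nX (s k)).
      (\<lambda>i. h (f i)) \<in> seq_dual (\<Theta> k) (n\<Theta> k) \<and>
      seq_dual_norm (\<Theta> k) (n\<Theta> k) (\<lambda>i. h (f i)) \<le> B0 * dual_norm (X (s k)) (nX (s k)) h"
    using bessel unfolding dual_bessel_def bessel_sequence_def by (elim conjE exE)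
  \<comment> \<open>The Bessel constant may be zero or negative, for instance on trivial spaces;
    this choice dominates it and is positive.\<close>
  define B where "B = \<bar>B0\<bar> + 1"
  show thesis
  proof (rule that[of B], simp add: B_def, intro allI)
    fix N c
    have fs: "f i \<in> X (s k)" for i using f by blast
    define y where "y = (\<Sum>i<N. sc (c i) (f i))"
    have y: "y \<in> X (s k)" unfolding y_def by (intro X.S.mem_sum X.S.mem_scale fs)
    obtain h where h: "h \<in> banach_dual sc (X (s k)) (nX (s k))"
      "\<forall>x\<in>X (s k). norm (h x) \<le> nX (s k) x" "norm (h y) = nX (s k) y"
      by (rule X.S.norming_functional[OF y])
    interpret h: linear_map_on sc "(*)" "X (s k)" h by (rule X.S.dual_linear[OF h(1)])
    have H: "dual_norm (X (s k)) (nX (s k)) h \<le> 1"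
      by (rule X.S.dual_norm_le) (use h(2) in simp_all)
    have "(\<lambda>i. h (f i)) \<in> seq_dual (\<Theta> k) (n\<Theta> k)" using B0 h(1) by blast
    then obtain \<phi> where \<phi>: "\<phi> \<in> banach_dual fun_scale (\<Theta> k) (n\<Theta> k)"
      and eq: "(\<lambda>i. h (f i)) = (\<lambda>i. \<phi> (unit_seq i))"
      unfolding seq_dual_def by blast
    have "dual_norm (\<Theta> k) (n\<Theta> k) \<phi> \<le> B0 * dual_norm (X (s k)) (nX (s k)) h"
      unfolding seq_dual_norm_eq[OF CB \<phi>, symmetric] eq[symmetric] using B0 h(1) by blast
    also have "\<dots> \<le> \<bar>B0\<bar> * dual_norm (X (s k)) (nX (s k)) h"
      by (rule mult_right_mono[OF abs_ge_self X.S.dual_norm_nonneg[OF h(1)]])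
    also have "\<dots> \<le> \<bar>B0\<bar> * 1" by (rule mult_left_mono[OF H abs_ge_zero])
    finally have \<phi>_le: "dual_norm (\<Theta> k) (n\<Theta> k) \<phi> \<le> B" by (simp add: B_def)
    \<comment> \<open>The norming functional sees in \<open>y\<close> the same finite sum that
      \<open>\<phi>\<close> sees in \<open>truncate N c\<close>, so the norm of \<open>y\<close> is
      a value of \<open>\<phi>\<close>.\<close>
    have "h y = (\<Sum>i<N. c i * h (f i))" unfolding y_def by (rule h.sum_scale[OF fs])
    also have "\<dots> = \<phi> (truncate N c)"
      unfolding CB_dual_truncate[OF CB \<phi>] fun_cong[OF eq] ..
    finally have "nX (s k) y = norm (\<phi> (truncate N c))" using h(3) by simp
    also have "\<dots> \<le> dual_norm (\<Theta> k) (n\<Theta> k) \<phi> * n\<Theta> k (truncate N c)"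
      by (rule T.S.norm_le_dual_norm[OF \<phi> truncate_mem])
    also have "\<dots> \<le> B * n\<Theta> k (truncate N c)"
      by (rule mult_right_mono[OF \<phi>_le T.S.nonneg[OF truncate_mem]])
    finally show "nX (s k) (\<Sum>i<N. sc (c i) (f i)) \<le> B * n\<Theta> k (truncate N c)"
      unfolding y_def .
  qed
qed

text \<open>The bound on finite sums, applied to differences of truncations, makes the partial sums
  Cauchy in all norms of index \<open>s k\<close>. Completeness of \<open>XF\<close> provides the
  limit \<open>V d\<close>, and the same bound passes to it.\<close>

lemma bessel_operator:
  assumes f: "\<And>i. f i \<in> XF" and bessel: "\<And>k. dual_bessel sc X nX (\<Theta> k) (n\<Theta> k) (s k) f"
  obtains V where "operator_on fun_scale sc \<Theta>F XF V"
    "\<forall>k. \<exists>C>0. \<forall>d\<in>\<Theta>F. nX (s k) (V d) \<le> C * n\<Theta> k d"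
    "\<forall>d\<in>\<Theta>F. \<forall>r. (\<lambda>N. nX r ((\<Sum>i<N. sc (d i) (f i)) - V d)) \<longlonglongrightarrow> 0"
proof -
  define S where "S = (\<lambda>d N. \<Sum>i<(N::nat). sc (d i) (f i))"
  have S: "S d N \<in> XF" for d N
    unfolding S_def by (intro subspace_sum subspace_scale X.subspace_YF f)
  have Sr: "S d N \<in> X r" for d N r using S by blast
  \<comment> \<open>Partial sums of different lengths become sums of the common length
    \<open>max i j\<close> once the coefficients are truncated; their difference is then again a
    finite combination to which the Bessel bound applies.\<close>
  have diff: "S d i - S d j = S (truncate i d - truncate j d) (max i j)" for d i j
  proof -
    have tr: "S d i = (\<Sum>l<m. sc (truncate i d l) (f l))" if "i \<le> m" for i m
      unfolding S_def by (rule sum.mono_neutral_cong_left) (use that in \<open>auto simp: truncate_def\<close>)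
    show ?thesis
      unfolding tr[OF max.cobounded1[of i j]] tr[OF max.cobounded2[of j i]]
      by (simp add: S_def scale_left_diff_distrib sum_subtractf)
  qed
  have diff_bound: "nX (s k) (S d i - S d j) \<le> B * n\<Theta> k (truncate i d - truncate j d)"
    if "\<forall>N c. nX (s k) (\<Sum>i<N. sc (c i) (f i)) \<le> B * n\<Theta> k (truncate N c)" for B k d i j
  proof -
    have "truncate (max i j) (truncate i d - truncate j d) = truncate i d - truncate j d"
      by (rule ext) (simp add: truncate_def)
    then show ?thesis
      using that[rule_format, of "truncate i d - truncate j d" "max i j"]
      unfolding diff by (simp add: S_def)
  qed
  have "\<exists>l. l \<in> XF \<and> (\<forall>r. (\<lambda>N. nX r (S d N - l)) \<longlonglongrightarrow> 0)" if d: "d \<in> \<Theta>F" for d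
  proof (rule X.frechet_complete[OF s_at_top S])
    fix k and e :: real assume e: "e > 0"
    obtain B where B: "B > 0" "\<forall>N c. nX (s k) (\<Sum>i<N. sc (c i) (f i)) \<le> B * n\<Theta> k (truncate N c)"
      by (rule bessel_bound[OF f bessel])
    have dk: "d \<in> \<Theta> k" using d by blast
    have "e / B > 0" using e B(1) by simp
    from T.S.convergent_imp_Cauchy[OF truncate_mem dk truncate_limit[OF dk] this]
    obtain M where M: "\<forall>i\<ge>M. \<forall>j\<ge>M. n\<Theta> k (truncate i d - truncate j d) < e / B" by blast
    have "nX (s k) (S d i - S d j) < e" if "i \<ge> M" "j \<ge> M" for i j
    proof -
      have "n\<Theta> k (truncate i d - truncate j d) < e / B" using M that by blast
      then have "B * n\<Theta> k (truncate i d - truncate j d) < e"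
        using B(1) by (simp add: pos_less_divide_eq mult.commute)
      with diff_bound[OF B(2)] show ?thesis by (rule le_less_trans)
    qed
    then show "\<exists>M. \<forall>i\<ge>M. \<forall>j\<ge>M. nX (s k) (S d i - S d j) < e" by blast
  qed (intro exI conjI)
  then have "\<forall>d\<in>\<Theta>F. \<exists>l. l \<in> XF \<and> (\<forall>r. (\<lambda>N. nX r (S d N - l)) \<longlonglongrightarrow> 0)" ..
  from bchoice[OF this] obtain V where
    V: "\<forall>d\<in>\<Theta>F. V d \<in> XF \<and> (\<forall>r. (\<lambda>N. nX r (S d N - V d)) \<longlonglongrightarrow> 0)" ..
  have Vmem: "V d \<in> XF" and Vlim: "(\<lambda>N. nX r (S d N - V d)) \<longlonglongrightarrow> 0" if "d \<in> \<Theta>F" for d r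
    using V that by blast+
  have Vr: "V d \<in> X r" if "d \<in> \<Theta>F" for d r using Vmem[OF that] by blast
  \<comment> \<open>The weakest norm already identifies the values of \<open>V\<close>, so linearity
    needs to be checked only for limits in \<open>X 0\<close>.\<close>
  have uniq: "V d = l" if d: "d \<in> \<Theta>F" and l: "l \<in> X 0" and lim: "(\<lambda>N. nX 0 (S d N - l)) \<longlonglongrightarrow> 0" for d l
    by (rule X.S.limit_unique[OF Sr Vr[OF d] l Vlim[OF d] lim])
  have add: "V (c + d) = V c + V d" if c: "c \<in> \<Theta>F" and d: "d \<in> \<Theta>F" for c d
  proof (rule uniq)
    show "c + d \<in> \<Theta>F" by (rule T.subspace_add[OF T.subspace_YF c d])
    show "V c + V d \<in> X 0" by (intro X.S.mem_add Vr c d)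
    have eq: "S (c + d) N - (V c + V d) = (S c N - V c) + (S d N - V d)" for N
      by (simp add: S_def scale_left_distrib sum.distrib)
    have mem: "S c N - V c \<in> X 0" "S d N - V d \<in> X 0" for N
      by (intro X.S.mem_diff Sr Vr c d)+
    have lim: "(\<lambda>N. nX 0 (S c N - V c) + nX 0 (S d N - V d)) \<longlonglongrightarrow> 0"
      using tendsto_add[OF Vlim[OF c] Vlim[OF d]] by simp
    show "(\<lambda>N. nX 0 (S (c + d) N - (V c + V d))) \<longlonglongrightarrow> 0"
      unfolding eq
      by (rule tendsto_sandwich[OF _ _ tendsto_const lim])
         (intro eventuallyI X.S.nonneg X.S.mem_add mem, intro eventuallyI X.S.triangle mem)
  qed
  have scale: "V (fun_scale a d) = sc a (V d)" if d: "d \<in> \<Theta>F" for a d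
  proof (rule uniq)
    show "fun_scale a d \<in> \<Theta>F" by (rule T.subspace_scale[OF T.subspace_YF d])
    show "sc a (V d) \<in> X 0" by (intro X.S.mem_scale Vr d)
    have eq: "S (fun_scale a d) N - sc a (V d) = sc a (S d N - V d)" for N
      by (simp add: S_def fun_scale_def scale_right_diff_distrib scale_sum_right)
    show "(\<lambda>N. nX 0 (S (fun_scale a d) N - sc a (V d))) \<longlonglongrightarrow> 0"
      unfolding eq X.S.norm_scale[OF X.S.mem_diff[OF Sr Vr[OF d]]]
      by (rule tendsto_mult_right_zero[OF Vlim[OF d]])
  qed
  have bound: "\<exists>C>0. \<forall>d\<in>\<Theta>F. nX (s k) (V d) \<le> C * n\<Theta> k d" for k
  proof -
    obtain B where B: "B > 0" "\<forall>N c. nX (s k) (\<Sum>i<N. sc (c i) (f i)) \<le> B * n\<Theta> k (truncate N c)"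
      by (rule bessel_bound[OF f bessel])
    have "nX (s k) (V d) \<le> B * n\<Theta> k d" if d: "d \<in> \<Theta>F" for d
    proof (rule LIMSEQ_le_const)
      have dk: "d \<in> \<Theta> k" using d by blast
      have "(\<lambda>N. B * n\<Theta> k d + (B * n\<Theta> k (truncate N d - d) + nX (s k) (S d N - V d)))
          \<longlonglongrightarrow> B * n\<Theta> k d + (B * 0 + 0)"
        by (intro tendsto_add tendsto_mult tendsto_const truncate_limit dk Vlim d)
      then show "(\<lambda>N. B * n\<Theta> k d + (B * n\<Theta> k (truncate N d - d) + nX (s k) (S d N - V d)))
          \<longlonglongrightarrow> B * n\<Theta> k d" by simp
      have "nX (s k) (V d) \<le> B * n\<Theta> k d + (B * n\<Theta> k (truncate N d - d) + nX (s k) (S d N - V d))" for N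
      proof -
        have "nX (s k) (V d) \<le> nX (s k) (S d N) + nX (s k) (S d N - V d)"
          using X.S.triangle_diff[OF Sr[of d N "s k"] X.S.mem_diff[OF Sr[of d N "s k"] Vr[OF d]]] by simp
        moreover have "nX (s k) (S d N) \<le> B * n\<Theta> k (truncate N d)"
          using B(2) unfolding S_def by blast
        moreover have "n\<Theta> k (truncate N d) \<le> n\<Theta> k d + n\<Theta> k (truncate N d - d)"
          using T.S.triangle[OF dk T.S.mem_diff[OF truncate_mem dk], of N d] by simp
        then have "B * n\<Theta> k (truncate N d) \<le> B * (n\<Theta> k d + n\<Theta> k (truncate N d - d))"
          using B(1) by (rule mult_left_mono[OF _ less_imp_le])
        ultimately show ?thesis by (simp add: distrib_left)
      qed
      then show "\<exists>M. \<forall>N\<ge>M. nX (s k) (V d)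
          \<le> B * n\<Theta> k d + (B * n\<Theta> k (truncate N d - d) + nX (s k) (S d N - V d))" by blast
    qed
    with B(1) show ?thesis by blast
  qed
  show thesis
  proof (rule that[of V])
    show "operator_on fun_scale sc \<Theta>F XF V"
      unfolding operator_on_def by (intro conjI ballI allI Vmem add scale)
    show "\<forall>k. \<exists>C>0. \<forall>d\<in>\<Theta>F. nX (s k) (V d) \<le> C * n\<Theta> k d" by (intro allI bound)
    show "\<forall>d\<in>\<Theta>F. \<forall>r. (\<lambda>N. nX r ((\<Sum>i<N. sc (d i) (f i)) - V d)) \<longlonglongrightarrow> 0"
      using Vlim unfolding S_def by blast
  qed
qed

text \<open>By \<open>E1\<close> and by the construction of \<open>V\<close>, one and the same
  series has the sums \<open>x\<close> and \<open>V (\<lambda>i. g i x)\<close>.\<close>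

lemma A2_imp_A1:
  assumes A2: "A2_sequence sc X nX \<Theta> n\<Theta> s g f"
  shows "\<exists>V. A1_operator sc X nX \<Theta> n\<Theta> s g V"
proof -
  have f: "f i \<in> XF" and bessel: "dual_bessel sc X nX (\<Theta> k) (n\<Theta> k) (s k) f"
    and E1: "E1 sc X nX g f" for i k
    using A2 unfolding A2_sequence_def by blast+
  obtain V where V: "operator_on fun_scale sc \<Theta>F XF V"
    "\<forall>k. \<exists>C>0. \<forall>d\<in>\<Theta>F. nX (s k) (V d) \<le> C * n\<Theta> k d"
    "\<forall>d\<in>\<Theta>F. \<forall>r. (\<lambda>N. nX r ((\<Sum>i<N. sc (d i) (f i)) - V d)) \<longlonglongrightarrow> 0"
    by (rule bessel_operator[OF f bessel])
  have "V (\<lambda>i. g i x) = x" if x: "x \<in> XF" for x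
  proof (rule X.S.limit_unique[of "\<lambda>N. \<Sum>i<N. sc (g i x) (f i)" 0])
    have f0: "f i \<in> X 0" for i using f by blast
    show "(\<Sum>i<N. sc (g i x) (f i)) \<in> X 0" for N
      by (intro X.S.mem_sum X.S.mem_scale f0)
    show "V (\<lambda>i. g i x) \<in> X 0" using V(1) coeff_mem[OF x] unfolding operator_on_def by blast
    show "x \<in> X 0" using x by blast
    show "(\<lambda>N. nX 0 ((\<Sum>i<N. sc (g i x) (f i)) - V (\<lambda>i. g i x))) \<longlonglongrightarrow> 0"
      by (rule V(3)[THEN bspec, OF coeff_mem[OF x], THEN spec])
    show "(\<lambda>N. nX 0 ((\<Sum>i<N. sc (g i x) (f i)) - x)) \<longlonglongrightarrow> 0"
      using E1 x unfolding E1_iff[OF f] by blast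
  qed
  with V show ?thesis unfolding A1_operator_def by blast
qed

text \<open>On \<open>XF\<close> the extended functionals coincide with the \<open>g i\<close>, so
  \<open>E3\<close> for all \<open>k\<close> is convergence of the series of \<open>E1\<close> in a
  cofinal family of norms.\<close>

lemma A3_imp_A2:
  assumes A3: "A3_sequence sc X nX \<Theta> n\<Theta> s t g f"
  shows "A2_sequence sc X nX \<Theta> n\<Theta> s g f"
proof -
  have f: "f i \<in> XF" and bessel: "dual_bessel sc X nX (\<Theta> k) (n\<Theta> k) (s k) f"
    and E3: "E3 sc X nX (s k) (t k) g f" for i k
    using A3 unfolding A3_sequence_def by blast+
  have "E1 sc X nX g f"
    unfolding E1_iff[OF f]
  proof (intro ballI allI)
    fix x r assume x: "x \<in> XF"
    show "(\<lambda>N. nX r ((\<Sum>i<N. sc (g i x) (f i)) - x)) \<longlonglongrightarrow> 0"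
    proof (rule X.limit_cofinal[OF s_at_top _ x])
      show "(\<Sum>i<N. sc (g i x) (f i)) \<in> XF" for N
        by (intro subspace_sum subspace_scale X.subspace_YF f)
      fix k
      have "x \<in> X (t k)" using x by blast
      from bspec[OF E3[of k, unfolded E3_iff[OF f]] this]
      show "(\<lambda>N. nX (s k) ((\<Sum>i<N. sc (g i x) (f i)) - x)) \<longlonglongrightarrow> 0"
        unfolding gext_eq[OF x] .
    qed
  qed
  with f bessel show ?thesis unfolding A2_sequence_def by blast
qed

lemma frame_imp_bessel:
  "dual_frame sc X nX (\<Theta> k) (n\<Theta> k) (s k) (t k) f \<Longrightarrow> dual_bessel sc X nX (\<Theta> k) (n\<Theta> k) (s k) f"
  unfolding dual_frame_def banach_frame_def dual_bessel_def bessel_sequence_def by blast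

text \<open>The operator synthesised from the Bessel sequence is a left inverse because \<open>E4\<close> identifies
  all functionals of \<open>V (g x)\<close> with those of \<open>x\<close>, and the dual separates points.\<close>

lemma A4_imp_A1:
  assumes A4: "A4_sequence sc X nX \<Theta> n\<Theta> s t g f"
  shows "\<exists>V. A1_operator sc X nX \<Theta> n\<Theta> s g V"
proof -
  have f: "f i \<in> XF" and frame: "dual_frame sc X nX (\<Theta> k) (n\<Theta> k) (s k) (t k) f"
    and E4: "E4 sc X nX (s k) (t k) g f" for i k
    using A4 unfolding A4_sequence_def by blast+
  obtain V where V: "operator_on fun_scale sc \<Theta>F XF V"
    "\<forall>k. \<exists>C>0. \<forall>d\<in>\<Theta>F. nX (s k) (V d) \<le> C * n\<Theta> k d"
    "\<forall>d\<in>\<Theta>F. \<forall>r. (\<lambda>N. nX r ((\<Sum>i<N. sc (d i) (f i)) - V d)) \<longlonglongrightarrow> 0"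
    by (rule bessel_operator[OF f frame_imp_bessel[OF frame]])
  have "V (\<lambda>i. g i x) = x" if x: "x \<in> XF" for x
  proof -
    \<comment> \<open>One index is enough: the norm of index \<open>s 0\<close> vanishes only at
      0.\<close>
    let ?p = "s 0" and ?q = "t 0"
    have xq: "x \<in> X ?q" and xp: "x \<in> X ?p" using x by blast+
    have Vp: "V (\<lambda>i. g i x) \<in> X ?p" using V(1) coeff_mem[OF x] unfolding operator_on_def by blast
    have fp: "f i \<in> X ?p" for i using f by blast
    obtain h where h: "h \<in> banach_dual sc (X ?p) (nX ?p)" and "\<forall>x\<in>X ?p. norm (h x) \<le> nX ?p x"
      and norming: "norm (h (V (\<lambda>i. g i x) - x)) = nX ?p (V (\<lambda>i. g i x) - x)"
      by (rule X.S.norming_functional[OF X.S.mem_diff[OF Vp xp]])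
    interpret h: linear_map_on sc "(*)" "X ?p" h by (rule X.S.dual_linear[OF h])
    have sum: "(\<Sum>i<N. sc (g i x) (f i)) \<in> X ?p" for N by (intro X.S.mem_sum X.S.mem_scale fp)
    have lim: "(\<lambda>N. nX ?p ((\<Sum>i<N. sc (g i x) (f i)) - V (\<lambda>i. g i x))) \<longlonglongrightarrow> 0"
      by (rule V(3)[THEN bspec, OF coeff_mem[OF x], THEN spec])
    have lim1: "(\<lambda>N. \<Sum>i<N. g i x * h (f i)) \<longlonglongrightarrow> h (V (\<lambda>i. g i x))"
      using X.S.dual_limit[OF h sum Vp lim] unfolding h.sum_scale[OF fp] .
    \<comment> \<open>Evaluating the remainder at the fixed \<open>x\<close> turns norm convergence
      in the dual into scalar convergence. The sums are those of \<open>lim1\<close>, so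
      \<open>h\<close> takes the same value at \<open>x\<close> and at
      \<open>V (\<lambda>i. g i x)\<close>.\<close>
    let ?R = "\<lambda>N. h - (\<Sum>i<N. fun_scale (h (f i)) (gext 0 i))"
    have R: "?R N \<in> banach_dual sc (X ?q) (nX ?q)" for N
      by (intro X.S.banach_dual_combination dual_s_t h gext_dual)
    have "(\<lambda>N. dual_norm (X ?q) (nX ?q) (?R N)) \<longlonglongrightarrow> 0"
      using E4[of 0] h unfolding E4_def by blast
    then have "(\<lambda>N. dual_norm (X ?q) (nX ?q) (?R N) * nX ?q x) \<longlonglongrightarrow> 0"
      by (rule tendsto_mult_left_zero)
    then have "(\<lambda>N. ?R N x) \<longlonglongrightarrow> 0"
      by (rule Lim_null_comparison[OF eventuallyI, rotated])
         (rule X.S.norm_le_dual_norm[OF R xq])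
    moreover have "?R N x = h x - (\<Sum>i<N. g i x * h (f i))" for N
      by (simp add: sum_fun_apply fun_scale_def gext_eq[OF x] mult.commute)
    ultimately have "(\<lambda>N. h x - (\<Sum>i<N. g i x * h (f i))) \<longlonglongrightarrow> 0" by simp
    moreover have "(\<lambda>N. h x - (\<Sum>i<N. g i x * h (f i))) \<longlonglongrightarrow> h x - h (V (\<lambda>i. g i x))"
      by (intro tendsto_diff tendsto_const lim1)
    ultimately have "h x - h (V (\<lambda>i. g i x)) = 0" using LIMSEQ_unique by blast
    then have "nX ?p (V (\<lambda>i. g i x) - x) = 0"
      using norming h.diff[OF Vp xp] by simp
    then show ?thesis using X.S.eq_0_iff[OF X.S.mem_diff[OF Vp xp]] by simp
  qed
  with V show ?thesis unfolding A1_operator_def by blast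
qed

lemma continuous_operator_expansions:
  assumes V: "operator_on fun_scale sc \<Theta>F XF V"
    and cont: "continuous_map (frechet_topology \<Theta> n\<Theta>) (frechet_topology X nX) V"
    and left_inverse: "\<forall>x\<in>XF. V (\<lambda>i. g i x) = x"
  shows "\<exists>f. (\<forall>i. f i \<in> XF) \<and> E1 sc X nX g f \<and> E2 sc X nX g f"
proof (intro exI conjI allI)
  show f: "V (unit_seq i) \<in> XF" for i
    using V unit_seq_mem unfolding operator_on_def by blast
  show E1: "E1 sc X nX g (\<lambda>i. V (unit_seq i))" by (rule continuous_operator_E1[OF assms])
  show "E2 sc X nX g (\<lambda>i. V (unit_seq i))" by (rule X.E1_imp_E2[OF g_dual f E1])
qed

lemma A1_expansions:
  assumes "A1_operator sc X nX \<Theta> n\<Theta> s g V \<and> f = (\<lambda>i. V (unit_seq i))"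
  shows "(\<forall>i. f i \<in> XF) \<and> E1 sc X nX g f \<and> E2 sc X nX g f \<and> (\<forall>k. E3 sc X nX (s k) (t k) g f)"
proof -
  note A1 = assms[THEN conjunct1]
  show ?thesis
    unfolding assms[THEN conjunct2]
    by (intro conjI allI V_unit_mem[OF A1] A1_E1[OF A1] A1_E2[OF A1] A1_E3[OF A1])
qed

text \<open>The cycle from A1 to A3, from A3 to A2 and from A2 back to A1 yields both
  equivalences.\<close>

lemma A1_iff_A2_iff_A3:
  "((\<exists>V. A1_operator sc X nX \<Theta> n\<Theta> s g V) \<longleftrightarrow> (\<exists>f. A2_sequence sc X nX \<Theta> n\<Theta> s g f)) \<and>
   ((\<exists>f. A2_sequence sc X nX \<Theta> n\<Theta> s g f) \<longleftrightarrow> (\<exists>f. A3_sequence sc X nX \<Theta> n\<Theta> s t g f))"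
proof -
  have "A3_sequence sc X nX \<Theta> n\<Theta> s t g (\<lambda>i. V (unit_seq i))"
    if A1: "A1_operator sc X nX \<Theta> n\<Theta> s g V" for V
    unfolding A3_sequence_def by (intro conjI allI V_unit_mem[OF A1] A1_E3[OF A1] A1_bessel[OF A1])
  with A2_imp_A1 A3_imp_A2 show ?thesis by blast
qed

lemma A1_iff_A4:
  assumes "\<forall>k. CB_space (seq_dual (\<Theta> k) (n\<Theta> k)) (seq_dual_norm (\<Theta> k) (n\<Theta> k))"
  shows "(\<exists>V. A1_operator sc X nX \<Theta> n\<Theta> s g V) \<longleftrightarrow> (\<exists>f. A4_sequence sc X nX \<Theta> n\<Theta> s t g f)"
proof -
  have "A4_sequence sc X nX \<Theta> n\<Theta> s t g (\<lambda>i. V (unit_seq i))"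
    if A1: "A1_operator sc X nX \<Theta> n\<Theta> s g V" for V
    unfolding A4_sequence_def
    by (intro conjI allI V_unit_mem[OF A1] A1_frame[OF A1] A1_E4[OF A1 assms[THEN spec]])
  with A4_imp_A1 show ?thesis by blast
qed

end

theorem theorem3p1:
  fixes sc :: "'k::{real_normed_field,euclidean_space} \<Rightarrow> 'a::ab_group_add \<Rightarrow> 'a"
    and X :: "nat \<Rightarrow> 'a set" and nX :: "nat \<Rightarrow> 'a \<Rightarrow> real"
    and \<Theta> :: "nat \<Rightarrow> (nat \<Rightarrow> 'k) set" and n\<Theta> :: "nat \<Rightarrow> (nat \<Rightarrow> 'k) \<Rightarrow> real"
    and s t :: "nat \<Rightarrow> nat" and g :: "nat \<Rightarrow> 'a \<Rightarrow> 'k"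
  assumes "vector_space sc"
    and "admissible_scale sc X nX"
    and "admissible_scale fun_scale \<Theta> n\<Theta>"
    and "\<forall>k. BK_space (\<Theta> k) (n\<Theta> k)"
    and "pre_frechet_frame sc X nX \<Theta> n\<Theta> s t g"
  shows
    "((\<forall>k. CB_space (\<Theta> k) (n\<Theta> k)) \<and>
      (\<exists>V. operator_on fun_scale sc (\<Inter>r. \<Theta> r) (\<Inter>r. X r) V \<and>
           continuous_map (frechet_topology \<Theta> n\<Theta>) (frechet_topology X nX) V \<and>
           (\<forall>x\<in>(\<Inter>r. X r). V (\<lambda>i. g i x) = x))
      \<longrightarrow> (\<exists>f. (\<forall>i. f i \<in> (\<Inter>r. X r)) \<and> E1 sc X nX g f \<and> E2 sc X nX g f))
     \<and>
     ((\<forall>k. CB_space (\<Theta> k) (n\<Theta> k))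
      \<longrightarrow> ((\<exists>V. A1_operator sc X nX \<Theta> n\<Theta> s g V) \<longleftrightarrow> (\<exists>f. A2_sequence sc X nX \<Theta> n\<Theta> s g f)) \<and>
          ((\<exists>f. A2_sequence sc X nX \<Theta> n\<Theta> s g f) \<longleftrightarrow> (\<exists>f. A3_sequence sc X nX \<Theta> n\<Theta> s t g f)) \<and>
          (\<forall>V f. A1_operator sc X nX \<Theta> n\<Theta> s g V \<and> f = (\<lambda>i. V (unit_seq i)) \<longrightarrow>
             (\<forall>i. f i \<in> (\<Inter>r. X r)) \<and> E1 sc X nX g f \<and> E2 sc X nX g f \<and>
             (\<forall>k. E3 sc X nX (s k) (t k) g f)))
     \<and>
     ((\<forall>k. CB_space (\<Theta> k) (n\<Theta> k)) \<and>
      (\<forall>k. CB_space (seq_dual (\<Theta> k) (n\<Theta> k)) (seq_dual_norm (\<Theta> k) (n\<Theta> k)))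
      \<longrightarrow> ((\<exists>V. A1_operator sc X nX \<Theta> n\<Theta> s g V) \<longleftrightarrow> (\<exists>f. A4_sequence sc X nX \<Theta> n\<Theta> s t g f)) \<and>
          (\<forall>V f. A1_operator sc X nX \<Theta> n\<Theta> s g V \<and> f = (\<lambda>i. V (unit_seq i)) \<longrightarrow>
             (\<forall>i. f i \<in> (\<Inter>r. X r)) \<and> E1 sc X nX g f \<and> E2 sc X nX g f \<and>
             (\<forall>k. E3 sc X nX (s k) (t k) g f \<and> E4 sc X nX (s k) (t k) g f)))"
proof -
  have setting: "frame_setting sc X nX \<Theta> n\<Theta> s t g" if CB: "\<forall>k. CB_space (\<Theta> k) (n\<Theta> k)"
    by (rule frame_setting.intro[OF assms(1) frame_setting_axioms.intro[OF assms(2,3,5) CB[THEN spec]]])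
  show ?thesis
  proof (rule conjI[OF impI conjI[OF impI impI]], goal_cases)
    case 1
    note CB = 1[THEN conjunct1]
    from 1[THEN conjunct2] show ?case
      by (elim conjE exE) (rule frame_setting.continuous_operator_expansions[OF setting[OF CB]])
  next
    case CB: 2
    note b = frame_setting.A1_iff_A2_iff_A3[OF setting[OF CB]]
    show ?case
      by (rule conjI[OF b[THEN conjunct1] conjI[OF b[THEN conjunct2]]],
          intro allI impI, rule frame_setting.A1_expansions[OF setting[OF CB]])
  next
    case 3
    note CB = 3[THEN conjunct1] and CB_dual = 3[THEN conjunct2]
    show ?case
    proof (rule conjI[OF frame_setting.A1_iff_A4[OF setting[OF CB] CB_dual]], intro allI impI)
      fix V f assume V: "A1_operator sc X nX \<Theta> n\<Theta> s g V \<and> f = (\<lambda>i. V (unit_seq i))"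
      have E4: "E4 sc X nX (s k) (t k) g f" for k
        unfolding V[THEN conjunct2]
        by (rule frame_setting.A1_E4[OF setting[OF CB] V[THEN conjunct1] CB_dual[THEN spec]])
      note E = frame_setting.A1_expansions[OF setting[OF CB] V]
      show "(\<forall>i. f i \<in> (\<Inter>r. X r)) \<and> E1 sc X nX g f \<and> E2 sc X nX g f \<and>
          (\<forall>k. E3 sc X nX (s k) (t k) g f \<and> E4 sc X nX (s k) (t k) g f)"
        by (intro conjI allI E[THEN conjunct1, THEN spec] E[THEN conjunct2, THEN conjunct1]
            E[THEN conjunct2, THEN conjunct2, THEN conjunct1]
            E[THEN conjunct2, THEN conjunct2, THEN conjunct2, THEN spec] E4)
    qed
  qed
qed

end
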